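(* Let $A_1,A_2\in\mathcal M_2(\mathbb C)$, $B\in\mathbb C^2$, $\Lambda_1>\Lambda_2>0$, and $T\in(0,+\infty)$. Then the system $$x(t)=A_1x(t-\Lambda_1)+A_2x(t-\Lambda_2)+Bu(t),\qquad x(t)\in\mathbb C^2,\ u(t)\in\mathbb C,$$ is exactly controllable in time $T$ if and only if it is exactly controllable to constants in time $T$.
   Context: Let $\mathsf X=L^2((-\Lambda_1,0),\mathbb C^2)$ and $\mathsf Y_T=L^2((0,T),\mathbb C)$. For $x_0\in\mathsf X$ and $u\in\mathsf Y_T$, the solution with initial condition $x_0$ and control $u$ is the unique (up to a.e. equality) function $x:(-\Lambda_1,T)\to\mathbb C^2$ equal to $x_0$ on $(-\Lambda_1,0)$ and satisfying the equation for (almost) every $t\in(0,T)$. For $t \in [0,T]$, $x_t\in\mathsf X$ is $x_t(s)=x(t+s)$, $s\in(-\Lambda_1,0)$. The system is exactly controllable in time $T$ if for every $x_0,y\in\mathsf X$ there is $u\in\mathsf Y_T$ such that the solution with initial condition $x_0$ and control $u$ satisfies $x_T=y$. Let $\mathsf K\subset\mathsf X$ be the set of constant functions $(-\Lambda_1,0)\to\mathbb C^2$. The system is exactly controllable to constants in time $T$ if for every $y\in\mathsf K$ there is $u\in\mathsf Y_T$ such that the solution with initial condition $0$ and control $u$ satisfies $x_T=y$. *)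

theory Defs
  imports "HOL-Analysis.Analysis"
begin

text \<open>
  Elements of $L^2(S)$ are represented by total functions on the reals of which only the
  restriction to \<open>S\<close> matters; equality in $L^2(S)$ is almost-everywhere equality on \<open>S\<close>.
\<close>

definition L2_space :: "real set \<Rightarrow> (real \<Rightarrow> 'a::euclidean_space) set" where
  "L2_space S = {f \<in> borel_measurable (lebesgue_on S).
                   integrable (lebesgue_on S) (\<lambda>t. (norm (f t))\<^sup>2)}"

definition L2_eq :: "real set \<Rightarrow> (real \<Rightarrow> 'a::euclidean_space) \<Rightarrow> (real \<Rightarrow> 'a) \<Rightarrow> bool" where
  "L2_eq S f g \<longleftrightarrow> (AE t in lebesgue_on S. f t = g t)"

definition state_space :: "real \<Rightarrow> (real \<Rightarrow> complex ^ 2) set" where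
  "state_space \<Lambda>1 = L2_space {-\<Lambda>1<..<0}"

definition control_space :: "real \<Rightarrow> (real \<Rightarrow> complex) set" where
  "control_space T = L2_space {0<..<T}"

definition constant_states :: "real \<Rightarrow> (real \<Rightarrow> complex ^ 2) set" where
  "constant_states \<Lambda>1 = {y \<in> state_space \<Lambda>1. \<exists>c. \<forall>s\<in>{-\<Lambda>1<..<0}. y s = c}"

definition is_solution ::
  "complex ^ 2 ^ 2 \<Rightarrow> complex ^ 2 ^ 2 \<Rightarrow> complex ^ 2 \<Rightarrow> real \<Rightarrow> real \<Rightarrow> real \<Rightarrow>
    (real \<Rightarrow> complex ^ 2) \<Rightarrow> (real \<Rightarrow> complex) \<Rightarrow> (real \<Rightarrow> complex ^ 2) \<Rightarrow> bool" where
  "is_solution A1 A2 B \<Lambda>1 \<Lambda>2 T x0 u x \<longleftrightarrow>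
     L2_eq {-\<Lambda>1<..<0} x x0 \<and>
     (AE t in lebesgue_on {0<..<T}.
        x t = A1 *v x (t - \<Lambda>1) + A2 *v x (t - \<Lambda>2) + u t *s B)"

definition state_at :: "(real \<Rightarrow> complex ^ 2) \<Rightarrow> real \<Rightarrow> real \<Rightarrow> complex ^ 2" where
  "state_at x t = (\<lambda>s. x (t + s))"

text \<open>
  A solution exists and is unique up to almost-everywhere equality on $(-\Lambda_1, T)$ (the
  equation determines it successively on intervals of length \<open>\<Lambda>2\<close>), so ``the solution satisfies
  $x_T = y$'' is the same as ``some solution satisfies $x_T = y$''.
\<close>

definition exactly_controllable ::
  "complex ^ 2 ^ 2 \<Rightarrow> complex ^ 2 ^ 2 \<Rightarrow> complex ^ 2 \<Rightarrow> real \<Rightarrow> real \<Rightarrow> real \<Rightarrow> bool" where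
  "exactly_controllable A1 A2 B \<Lambda>1 \<Lambda>2 T \<longleftrightarrow>
     (\<forall>x0\<in>state_space \<Lambda>1. \<forall>y\<in>state_space \<Lambda>1. \<exists>u\<in>control_space T. \<exists>x.
        is_solution A1 A2 B \<Lambda>1 \<Lambda>2 T x0 u x \<and> L2_eq {-\<Lambda>1<..<0} (state_at x T) y)"

definition exactly_controllable_to_constants ::
  "complex ^ 2 ^ 2 \<Rightarrow> complex ^ 2 ^ 2 \<Rightarrow> complex ^ 2 \<Rightarrow> real \<Rightarrow> real \<Rightarrow> real \<Rightarrow> bool" where
  "exactly_controllable_to_constants A1 A2 B \<Lambda>1 \<Lambda>2 T \<longleftrightarrow>
     (\<forall>y\<in>constant_states \<Lambda>1. \<exists>u\<in>control_space T. \<exists>x.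
        is_solution A1 A2 B \<Lambda>1 \<Lambda>2 T (\<lambda>_. 0) u x \<and> L2_eq {-\<Lambda>1<..<0} (state_at x T) y)"

end

theory Submission
  imports Defs
begin

text \<open>
  Only the sufficiency of the constant targets needs an argument. Let \<open>w \<noteq> 0\<close> be a row vector with
  \<open>w B = 0\<close>. Then \<open>z = w x\<close> satisfies an equation without control, a second coordinate
  \<open>p = r x\<close> is free, and both are images of one function \<open>P\<close> that vanishes before time 0 (a flat output):
  for the choices of \<open>r\<close> that matter, either \<open>p = P - a P(\<cdot> - \<Lambda>1)\<close>, \<open>z = P(\<cdot> - \<Lambda>2)\<close>, which is elementary,
  or \<open>p = P - \<gamma> P(\<cdot> - \<Lambda>2)\<close>, \<open>z = P(\<cdot> - \<Lambda>1) + \<beta> P(\<cdot> - \<Lambda>2)\<close>. For \<open>\<gamma> = e\<^sup>\<mu>\<^sup>\<Lambda>\<^sup>2\<close> the substitution \<open>P(t) = e\<^sup>\<mu>\<^sup>t Q(t)\<close>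
  turns the prescription of the final state into one equation \<open>Q(t - \<Lambda>1) + \<rho> Q(t) = g(t)\<close> for a
  \<open>\<Lambda>2\<close>-periodic \<open>Q\<close>. It is uniquely solvable in \<open>L\<^sup>2\<close> for all \<open>g\<close> unless \<open>-\<rho>\<close> is in the closure of
  the eigenvalues \<open>exp(-2\<pi>\<i>n\<Lambda>1/\<Lambda>2)\<close> of the rotation. For constant targets \<open>g\<close> is an exponential or an affine
  function on a period, so its Fourier coefficients decay no faster than \<open>1/n\<close>, whereas inhomogeneous
  Diophantine approximation makes \<open>exp(-2\<pi>\<i>n\<Lambda>1/\<Lambda>2) + \<rho>\<close> of size \<open>O(1/n)\<close> for infinitely many \<open>n\<close> in the resonant
  case; the Fourier coefficients of \<open>Q\<close> would then not tend to 0. Finally, uniqueness shows that the equilibrium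
  \<open>P = 1\<close> is the only flat output reaching its constant target, which forces \<open>T \<ge> 2\<Lambda>1\<close>.
\<close>

section \<open>Almost-everywhere statements and locally square-integrable functions\<close>

lemma AE_lborel_shift:
  fixes \<Phi> :: "real \<Rightarrow> bool"
  assumes "AE t in lborel. \<Phi> t"
  shows "AE t in lborel. \<Phi> (t + c)"
proof -
  obtain N where N: "\<And>t. t \<in> space lborel - N \<Longrightarrow> \<Phi> t" "N \<in> null_sets lborel"
    using AE_E3[OF assms] by blast
  then have [measurable]: "N \<in> sets borel" by auto
  have "AE t in lborel. t \<notin> N"
    using N by (rule_tac AE_not_in)
  then have "AE t in lborel. c + 1 * t \<notin> N"
    by (intro AE_borel_affine) auto
  then show ?thesis
    by eventually_elim (use N in \<open>auto simp: add.commute\<close>)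
qed

lemma AE_lborel_reflect:
  fixes \<Phi> :: "real \<Rightarrow> bool"
  assumes "AE t in lborel. \<Phi> t"
  shows "AE t in lborel. \<Phi> (- t)"
proof -
  obtain N where N: "\<And>t. t \<in> space lborel - N \<Longrightarrow> \<Phi> t" "N \<in> null_sets lborel"
    using AE_E3[OF assms] by blast
  then have [measurable]: "N \<in> sets borel" by auto
  have "AE t in lborel. t \<notin> N"
    using N by (rule_tac AE_not_in)
  then have "AE t in lborel. 0 + - 1 * t \<notin> N"
    by (intro AE_borel_affine) auto
  then show ?thesis
    by eventually_elim (use N in auto)
qed

lemma AE_interval_witness:
  fixes a b :: real
  assumes "a < b" and ae: "AE t in lborel. a < t \<longrightarrow> t < b \<longrightarrow> \<Phi> t"
  obtains t where "a < t" "t < b" "\<Phi> t"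
proof (rule ccontr)
  assume "\<not> thesis"
  with that have no: "\<not> \<Phi> t" if "a < t" "t < b" for t using that by blast
  have "AE t in lborel. t \<notin> {a<..<b}"
    using ae by eventually_elim (use no in auto)
  then have "{a<..<b} \<in> null_sets lborel"
    by (subst (asm) AE_iff_null_sets[symmetric]) auto
  then have "emeasure lborel {a<..<b} = 0" by auto
  with \<open>a < b\<close> show False by simp
qed

text \<open>The lattice is countable, so the null sets excluded by all translates can be discarded
  together. This permits pointwise arguments along the orbit of a generic point.\<close>

lemma AE_lborel_lattice:
  fixes \<Phi> :: "real \<Rightarrow> bool"
  assumes "AE t in lborel. \<Phi> t"
  shows "AE t in lborel. \<forall>i j :: int. \<Phi> (t + (of_int i * a + of_int j * b))"
  using AE_lborel_shift[OF assms] by (simp add: AE_all_countable)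

lemma AE_lebesgue_on_interval:
  fixes a b :: real
  shows "(AE t in lebesgue_on {a<..<b}. \<Phi> t) \<longleftrightarrow> (AE t in lborel. a < t \<longrightarrow> t < b \<longrightarrow> \<Phi> t)"
proof -
  have "(AE t in lebesgue_on {a<..<b}. \<Phi> t) \<longleftrightarrow> (AE t in lebesgue. t \<in> {a<..<b} \<longrightarrow> \<Phi> t)"
    by (rule AE_restrict_space_iff) simp
  also have "\<dots> \<longleftrightarrow> (AE t in lborel. t \<in> {a<..<b} \<longrightarrow> \<Phi> t)"
    by (rule AE_completion_iff)
  finally show ?thesis by (simp add: imp_conjL)
qed

text \<open>Off a null set all translates of \<open>t\<close> by the lattice generated by the two delays avoid the exceptional
  sets, so that the induction can be carried out pointwise.\<close>

lemma AE_delay_induct: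
  fixes d1 d2 s S :: real
  assumes d: "0 < d1" "0 < d2"
    and base: "AE t in lborel. t < s \<longrightarrow> G t"
    and step: "AE t in lborel. s < t \<longrightarrow> t < S \<longrightarrow> G (t - d1) \<longrightarrow> G (t - d2) \<longrightarrow> G t"
  shows "AE t in lborel. t < S \<longrightarrow> G t"
proof -
  \<comment> \<open>Base and step both leave out the point \<open>s\<close>.\<close>
  have ne: "AE t in lborel. t \<noteq> s"
    by (rule AE_lborel_singleton)
  from AE_lborel_lattice[OF base, of d1 d2] AE_lborel_lattice[OF step, of d1 d2]
    AE_lborel_lattice[OF ne, of d1 d2]
  show ?thesis
  proof eventually_elim
    case (elim t)
    define d where "d = min d1 d2"
    have dp: "0 < d" "d \<le> d1" "d \<le> d2" using d by (auto simp: d_def)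
    \<comment> \<open>Steps of the smaller delay: a point below \<open>s + (n + 1) * d\<close> has
      both delayed points below \<open>s + n * d\<close>. All lattice translates of \<open>t\<close>
      are treated at once, because the delayed points are again translates.\<close>
    have *: "\<forall>i j. t + (of_int i * d1 + of_int j * d2) < S \<longrightarrow>
        t + (of_int i * d1 + of_int j * d2) < s + of_nat n * d \<longrightarrow>
        G (t + (of_int i * d1 + of_int j * d2))" for n :: nat
    proof (induction n)
      case 0
      then show ?case using elim(1) by simp
    next
      case (Suc n)
      show ?case
      proof (intro allI impI)
        fix i j :: int
        define \<tau> where "\<tau> = t + (of_int i * d1 + of_int j * d2)"
        assume a: "t + (of_int i * d1 + of_int j * d2) < S"
          "t + (of_int i * d1 + of_int j * d2) < s + of_nat (Suc n) * d"
        have e1: "\<tau> - d1 = t + (of_int (i - 1) * d1 + of_int j * d2)"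
          and e2: "\<tau> - d2 = t + (of_int i * d1 + of_int (j - 1) * d2)"
          by (auto simp: \<tau>_def algebra_simps)
        show "G (t + (of_int i * d1 + of_int j * d2))"
        proof (cases "\<tau> < s")
          case True
          then show ?thesis using elim(1) by (simp add: \<tau>_def)
        next
          case False
          with elim(3) have "s < \<tau>" by (metis \<tau>_def linorder_neqE_linordered_idom)
          moreover have "\<tau> < s + (of_nat n * d + d)" "\<tau> < S"
            using a by (auto simp: \<tau>_def algebra_simps)
          then have "G (\<tau> - d1)" "G (\<tau> - d2)"
            using Suc.IH dp d unfolding e1 e2 by (smt (verit) e1 e2)+
          ultimately show ?thesis using elim(2) a by (simp add: \<tau>_def)
        qed
      qed
    qed
    obtain n :: nat where "(t - s) / d < of_nat n" using reals_Archimedean2 by blast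
    then have "t < s + of_nat n * d" using dp by (simp add: field_simps)
    with *[of n] show ?case
      by (metis add_0_right lambda_zero mult_zero_left of_int_0)
  qed
qed

text \<open>Functions live on the whole line, so the class is closed under translation; Borel
  measurability lets them be translated and pasted pointwise, and recursions then hold at every
  point instead of almost everywhere.\<close>

definition L2loc :: "(real \<Rightarrow> 'a::euclidean_space) \<Rightarrow> bool" where
  "L2loc f \<longleftrightarrow> f \<in> borel_measurable borel \<and>
     (\<forall>a b. set_integrable lborel {a..b} (\<lambda>t. (norm (f t))\<^sup>2))"

section \<open>Closure properties of locally square-integrable functions\<close>

lemma L2loc_measurable: "L2loc f \<Longrightarrow> f \<in> borel_measurable borel"
  by (simp add: L2loc_def)

lemma L2loc_integrable: "L2loc f \<Longrightarrow> set_integrable lborel {a..b} (\<lambda>t. (norm (f t))\<^sup>2)"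
  by (simp add: L2loc_def)

text \<open>The constant may depend on the interval, which admits multiplication by unbounded
  continuous functions such as exponentials.\<close>

lemma L2loc_bound:
  assumes f: "L2loc f" and [measurable]: "g \<in> borel_measurable borel"
    and le: "\<And>a b. \<exists>C. \<forall>t\<in>{a..b}. norm (g t) \<le> C * norm (f t)"
  shows "L2loc g"
  unfolding L2loc_def
proof (intro conjI allI)
  fix a b :: real
  obtain C where C: "\<And>t. t \<in> {a..b} \<Longrightarrow> norm (g t) \<le> C * norm (f t)" using le by metis
  have sq: "(norm (g t))\<^sup>2 \<le> C\<^sup>2 * (norm (f t))\<^sup>2" if "t \<in> {a..b}" for t
    using power_mono[OF C[OF that], of 2] by (simp add: power_mult_distrib)
  show "set_integrable lborel {a..b} (\<lambda>t. (norm (g t))\<^sup>2)"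
    by (rule set_integrable_bound[OF set_integrable_mult_right[OF L2loc_integrable[OF f, of a b], of "C\<^sup>2"]])
      (auto simp: set_borel_measurable_def sq)
qed simp

lemma L2loc_add:
  assumes f: "L2loc f" and g: "L2loc g"
  shows "L2loc (\<lambda>t. f t + g t)"
  unfolding L2loc_def
proof (intro conjI allI)
  note [measurable] = L2loc_measurable[OF f] L2loc_measurable[OF g]
  show "(\<lambda>t. f t + g t) \<in> borel_measurable borel" by simp
  fix a b :: real
  have sq: "(norm (f t + g t))\<^sup>2 \<le> 2 * (norm (f t))\<^sup>2 + 2 * (norm (g t))\<^sup>2" for t
  proof -
    have "(norm (f t + g t))\<^sup>2 \<le> (norm (f t) + norm (g t))\<^sup>2"
      by (intro power_mono norm_triangle_ineq) simp
    also have "\<dots> \<le> 2 * (norm (f t))\<^sup>2 + 2 * (norm (g t))\<^sup>2"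
      using sum_squares_ge_zero[of "norm (f t) - norm (g t)" 0]
      by (simp add: power2_eq_square algebra_simps)
    finally show ?thesis .
  qed
  have "set_integrable lborel {a..b} (\<lambda>t. 2 * (norm (f t))\<^sup>2 + 2 * (norm (g t))\<^sup>2)"
    by (intro set_integral_add(1) set_integrable_mult_right L2loc_integrable f g)
  then show "set_integrable lborel {a..b} (\<lambda>t. (norm (f t + g t))\<^sup>2)"
    by (rule set_integrable_bound) (auto simp: set_borel_measurable_def sq)
qed

lemma L2loc_linear:
  assumes T: "bounded_linear T" and f: "L2loc f"
  shows "L2loc (\<lambda>t. T (f t))"
proof (rule L2loc_bound[OF f])
  have [measurable]: "T \<in> borel_measurable borel"
    using T by (intro borel_measurable_continuous_onI linear_continuous_on)
  note [measurable] = L2loc_measurable[OF f]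
  show "(\<lambda>t. T (f t)) \<in> borel_measurable borel" by simp
  obtain K where "\<And>x. norm (T x) \<le> norm x * K" using bounded_linear.bounded[OF T] by blast
  then show "\<exists>C. \<forall>t\<in>{a..b}. norm (T (f t)) \<le> C * norm (f t)" for a b
    by (metis mult.commute)
qed

lemma L2loc_cmult: "L2loc f \<Longrightarrow> L2loc (\<lambda>t. c * f t :: complex)"
  by (rule L2loc_linear) (rule bounded_linear_mult_right)

lemma L2loc_uminus: "L2loc f \<Longrightarrow> L2loc (\<lambda>t. - f t)"
  by (rule L2loc_linear) (intro bounded_linear_minus bounded_linear_ident)

lemma L2loc_diff: "L2loc f \<Longrightarrow> L2loc g \<Longrightarrow> L2loc (\<lambda>t. f t - g t)"
  using L2loc_add[OF _ L2loc_uminus] by fastforce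

lemma L2loc_cont_mult:
  fixes f :: "real \<Rightarrow> complex"
  assumes c: "continuous_on UNIV c" and f: "L2loc f"
  shows "L2loc (\<lambda>t. c t * f t)"
proof (rule L2loc_bound[OF f])
  have [measurable]: "c \<in> borel_measurable borel"
    using c by (rule borel_measurable_continuous_onI)
  note [measurable] = L2loc_measurable[OF f]
  show "(\<lambda>t. c t * f t) \<in> borel_measurable borel" by simp
  fix a b :: real
  have "bounded (c ` {a..b})"
    by (intro compact_imp_bounded compact_continuous_image continuous_on_subset[OF c]) auto
  then obtain C where "\<And>t. t \<in> {a..b} \<Longrightarrow> norm (c t) \<le> C"
    unfolding bounded_iff by blast
  then show "\<exists>C. \<forall>t\<in>{a..b}. norm (c t * f t) \<le> C * norm (f t)"
    by (metis mult_right_mono norm_ge_zero norm_mult)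
qed

lemma L2loc_shift:
  assumes f: "L2loc f"
  shows "L2loc (\<lambda>t. f (t + c))"
  unfolding L2loc_def
proof (intro conjI allI)
  note [measurable] = L2loc_measurable[OF f]
  show "(\<lambda>t. f (t + c)) \<in> borel_measurable borel" by simp
  fix a b :: real
  have "integrable lborel (\<lambda>t. indicat_real {a + c..b + c} (c + 1 * t) *\<^sub>R (norm (f (c + 1 * t)))\<^sup>2)"
    using L2loc_integrable[OF f, of "a + c" "b + c"] unfolding set_integrable_def
    by (intro lborel_integrable_real_affine) auto
  also have "(\<lambda>t. indicat_real {a + c..b + c} (c + 1 * t) *\<^sub>R (norm (f (c + 1 * t)))\<^sup>2)
      = (\<lambda>t. indicat_real {a..b} t *\<^sub>R (norm (f (t + c)))\<^sup>2)"
    by (auto simp: fun_eq_iff indicator_def add.commute)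
  finally show "set_integrable lborel {a..b} (\<lambda>t. (norm (f (t + c)))\<^sup>2)"
    unfolding set_integrable_def .
qed

lemma L2loc_shift_minus: "L2loc f \<Longrightarrow> L2loc (\<lambda>t. f (t - c))"
  using L2loc_shift[of f "- c"] by simp

lemma L2loc_reflect:
  assumes f: "L2loc f"
  shows "L2loc (\<lambda>t. f (- t))"
  unfolding L2loc_def
proof (intro conjI allI)
  note [measurable] = L2loc_measurable[OF f]
  show "(\<lambda>t. f (- t)) \<in> borel_measurable borel" by simp
  fix a b :: real
  have "integrable lborel (\<lambda>t. indicat_real {-b..-a} (0 + -1 * t) *\<^sub>R (norm (f (0 + -1 * t)))\<^sup>2)"
    using L2loc_integrable[OF f, of "-b" "-a"] unfolding set_integrable_def
    by (intro lborel_integrable_real_affine) auto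
  also have "(\<lambda>t. indicat_real {-b..-a} (0 + -1 * t) *\<^sub>R (norm (f (0 + -1 * t)))\<^sup>2)
      = (\<lambda>t. indicat_real {a..b} t *\<^sub>R (norm (f (-t)))\<^sup>2)"
    by (auto simp: fun_eq_iff indicator_def)
  finally show "set_integrable lborel {a..b} (\<lambda>t. (norm (f (-t)))\<^sup>2)"
    unfolding set_integrable_def .
qed

lemma L2loc_if:
  assumes f: "L2loc f" and g: "L2loc g" and [measurable]: "Measurable.pred borel P"
  shows "L2loc (\<lambda>t. if P t then f t else g t)"
  unfolding L2loc_def
proof (intro conjI allI)
  note [measurable] = L2loc_measurable[OF f] L2loc_measurable[OF g]
  show "(\<lambda>t. if P t then f t else g t) \<in> borel_measurable borel" by simp
  fix a b :: real
  have "set_integrable lborel {a..b} (\<lambda>t. (norm (f t))\<^sup>2 + (norm (g t))\<^sup>2)"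
    by (intro set_integral_add(1) L2loc_integrable f g)
  then show "set_integrable lborel {a..b} (\<lambda>t. (norm (if P t then f t else g t))\<^sup>2)"
    by (rule set_integrable_bound) (auto simp: set_borel_measurable_def)
qed

lemma L2loc_const: "L2loc (\<lambda>_. c)"
  unfolding L2loc_def set_integrable_def
  by (auto intro!: integrable_real_indicator integrable_scaleR_left emeasure_lborel_Icc_eq simp: emeasure_lborel_Icc_eq)

lemma L2loc_sum: "finite S \<Longrightarrow> (\<And>i. i \<in> S \<Longrightarrow> L2loc (f i)) \<Longrightarrow> L2loc (\<lambda>t. \<Sum>i\<in>S. f i t)"
  by (induction S rule: finite_induct) (auto intro: L2loc_add L2loc_const)

lemma L2loc_imp_L2_space:
  assumes f: "L2loc f"
  shows "f \<in> L2_space {a<..<b}"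
proof -
  note [measurable] = L2loc_measurable[OF f]
  have "f \<in> borel_measurable lebesgue"
    using L2loc_measurable[OF f] by (simp add: measurable_completion)
  then have m: "f \<in> borel_measurable (lebesgue_on {a<..<b})"
    by (rule measurable_restrict_space1)
  have "set_integrable lborel {a<..<b} (\<lambda>t. (norm (f t))\<^sup>2)"
    by (rule set_integrable_subset[OF L2loc_integrable[OF f, of a b]]) auto
  then have "set_integrable lebesgue {a<..<b} (\<lambda>t. (norm (f t))\<^sup>2)"
    unfolding set_integrable_def by (subst integrable_completion) auto
  then have "integrable (lebesgue_on {a<..<b}) (\<lambda>t. (norm (f t))\<^sup>2)"
    by (simp add: set_integrable_def integrable_restrict_space)
  with m show ?thesis by (simp add: L2_space_def)
qed

lemma lebesgue_borel_representative:
  fixes f :: "real \<Rightarrow> 'a::euclidean_space"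
  assumes f: "f \<in> borel_measurable lebesgue"
  shows "\<exists>g\<in>borel_measurable borel. AE t in lborel. f t = g t"
proof -
  have "\<exists>g. g \<in> borel_measurable lborel \<and> (AE t in lborel. f t \<bullet> b = g t)" for b
    using completion_ex_borel_measurable_real[of "\<lambda>t. f t \<bullet> b" lborel] f by auto
  then obtain g where g: "\<And>b. g b \<in> borel_measurable borel" "\<And>b. AE t in lborel. f t \<bullet> b = g b t"
    by simp metis
  have "AE t in lborel. \<forall>b\<in>Basis. f t \<bullet> b = g b t"
    using g(2) by (intro AE_finite_allI) auto
  then have "AE t in lborel. f t = (\<Sum>b\<in>Basis. g b t *\<^sub>R b)"
    by eventually_elim (metis (no_types, lifting) euclidean_representation sum.cong)
  then show ?thesis
    using g(1) by (intro bexI[of _ "\<lambda>t. \<Sum>b\<in>Basis. g b t *\<^sub>R b"]) auto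
qed

text \<open>The passage from states and controls to \<open>L2loc\<close>: extension by zero turns
  square integrability on the interval into square integrability on the line, and a Borel
  representative is then chosen.\<close>

lemma L2_space_representative:
  fixes f :: "real \<Rightarrow> 'a::euclidean_space"
  assumes f: "f \<in> L2_space {a<..<b}"
  obtains g where "L2loc g" "AE t in lborel. a < t \<longrightarrow> t < b \<longrightarrow> f t = g t"
proof -
  define h where "h = (\<lambda>t. if t \<in> {a<..<b} then f t else 0)"
  have "h \<in> borel_measurable lebesgue"
    unfolding h_def using f by (intro borel_measurable_if_I) (auto simp: L2_space_def)
  then obtain g where [measurable]: "g \<in> borel_measurable borel" and g: "AE t in lborel. h t = g t"
    using lebesgue_borel_representative by blast
  have "integrable lebesgue (\<lambda>t. indicator {a<..<b} t *\<^sub>R (norm (f t))\<^sup>2)"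
    using f unfolding L2_space_def by (auto simp: integrable_restrict_space)
  also have "(\<lambda>t. indicator {a<..<b} t *\<^sub>R (norm (f t))\<^sup>2) = (\<lambda>t. (norm (h t))\<^sup>2)"
    by (auto simp: h_def indicator_def)
  finally have "integrable lebesgue (\<lambda>t. (norm (h t))\<^sup>2)" .
  then have "integrable lebesgue (\<lambda>t. (norm (g t))\<^sup>2)"
    using g by (subst integrable_cong_AE[where g="\<lambda>t. (norm (h t))\<^sup>2"])
      (auto simp: AE_completion_iff measurable_completion elim!: eventually_mono)
  then have i: "integrable lborel (\<lambda>t. (norm (g t))\<^sup>2)"
    by (subst (asm) integrable_completion) auto
  have "L2loc g"
    unfolding L2loc_def set_integrable_def
    by (intro conjI allI integrable_mult_indicator i) auto
  moreover have "AE t in lborel. a < t \<longrightarrow> t < b \<longrightarrow> f t = g t"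
    using g by eventually_elim (auto simp: h_def)
  ultimately show ?thesis by (rule that)
qed

text \<open>Method of steps: on an interval of length \<open>min d1 d2\<close> the right-hand side
  involves only values already fixed. It serves for trajectories, for flat outputs and, after time
  reversal, for recursions that run backwards.\<close>

lemma delay_recursion:
  fixes x0 f :: "real \<Rightarrow> 'a::euclidean_space"
  assumes d: "0 < d1" "0 < d2" and A: "bounded_linear A1" "bounded_linear A2"
    and x0: "L2loc x0" and f: "L2loc f"
  obtains x where "L2loc x" "\<And>t. t \<le> s \<Longrightarrow> x t = x0 t"
    "\<And>t. s < t \<Longrightarrow> t \<le> S \<Longrightarrow> x t = A1 (x (t - d1)) + A2 (x (t - d2)) + f t"
proof -
  define d where "d = min d1 d2"
  have dp: "0 < d" "d \<le> d1" "d \<le> d2" using d by (auto simp: d_def)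
  have "\<exists>x. L2loc x \<and> (\<forall>t\<le>s. x t = x0 t) \<and>
     (\<forall>t. s < t \<longrightarrow> t \<le> s + of_nat n * d \<longrightarrow> x t = A1 (x (t - d1)) + A2 (x (t - d2)) + f t)" for n
  proof (induction n)
    case 0
    then show ?case using x0 by auto
  next
    case (Suc n)
    then obtain x where x: "L2loc x" "\<And>t. t \<le> s \<Longrightarrow> x t = x0 t"
      "\<And>t. s < t \<Longrightarrow> t \<le> s + of_nat n * d \<Longrightarrow> x t = A1 (x (t - d1)) + A2 (x (t - d2)) + f t"
      by blast
    \<comment> \<open>Only values up to \<open>s + of_nat (Suc n) * d\<close> count; there both
      delayed arguments lie where \<open>y\<close> agrees with \<open>x\<close>.\<close>
    define y where "y = (\<lambda>t. if t \<le> s + of_nat n * d then x t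
       else A1 (x (t - d1)) + A2 (x (t - d2)) + f t)"
    have "0 \<le> of_nat n * d" using dp by simp
    have "L2loc y" unfolding y_def
      by (intro L2loc_if L2loc_add L2loc_linear[OF A(1)] L2loc_linear[OF A(2)] L2loc_shift_minus x f) simp
    moreover have "y t = x0 t" if "t \<le> s" for t
      using that x(2)[OF that] \<open>0 \<le> of_nat n * d\<close> by (auto simp: y_def)
    moreover have "y t = A1 (y (t - d1)) + A2 (y (t - d2)) + f t"
      if "s < t" "t \<le> s + of_nat (Suc n) * d" for t
    proof -
      have "t - d1 \<le> s + of_nat n * d" "t - d2 \<le> s + of_nat n * d"
        using that dp by (auto simp: algebra_simps)
      then show ?thesis
        using x(3)[of t] that by (simp add: y_def)
    qed
    ultimately show ?case by blast
  qed
  moreover obtain n :: nat where "(S - s) / d < of_nat n" using reals_Archimedean2 by blast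
  then have "S < s + of_nat n * d" using dp by (simp add: field_simps)
  ultimately obtain x where "L2loc x" "\<forall>t\<le>s. x t = x0 t"
     "\<forall>t. s < t \<longrightarrow> t \<le> S \<longrightarrow> x t = A1 (x (t - d1)) + A2 (x (t - d2)) + f t"
    by (smt (verit, best))
  then show ?thesis using that by blast
qed

section \<open>The equation of a rotation of the circle\<close>

definition periodic :: "real \<Rightarrow> (real \<Rightarrow> 'a) \<Rightarrow> bool" where
  "periodic L f \<longleftrightarrow> (\<forall>t. f (t + L) = f t)"

lemma periodic_int:
  assumes "periodic L f"
  shows "f (t + of_int k * L) = f t"
proof (induction k rule: int_induct[where k=0])
  case base
  then show ?case by simp
next
  case (step1 i)
  have "f (t + of_int (i + 1) * L) = f (t + of_int i * L + L)"
    by (simp add: algebra_simps)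
  then show ?case using step1 assms by (simp add: periodic_def)
next
  case (step2 i)
  have "f (t + of_int (i - 1) * L) = f (t + of_int (i - 1) * L + L)"
    using assms by (simp add: periodic_def)
  then show ?case using step2 by (simp add: algebra_simps)
qed

lemma periodic_shift: "periodic L f \<Longrightarrow> periodic L (\<lambda>t. f (t + h))"
  by (simp add: periodic_def) (metis add.commute add.left_commute)

lemma floor_divide_bounds:
  fixes t L :: real
  assumes "0 < L"
  shows "of_int \<lfloor>t / L\<rfloor> * L \<le> t" "t < of_int \<lfloor>t / L\<rfloor> * L + L"
proof -
  have "of_int \<lfloor>t / L\<rfloor> \<le> t / L" "t / L < of_int \<lfloor>t / L\<rfloor> + 1" by linarith+
  then show "of_int \<lfloor>t / L\<rfloor> * L \<le> t" "t < of_int \<lfloor>t / L\<rfloor> * L + L"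
    unfolding pos_le_divide_eq[OF assms] pos_divide_less_eq[OF assms]
    by (simp_all add: distrib_right)
qed

lemma exists_period_translate:
  fixes L :: real
  assumes "0 < L"
  obtains k :: int where "0 \<le> t + of_int k * L" "t + of_int k * L < L"
proof
  show "0 \<le> t + of_int (- \<lfloor>t / L\<rfloor>) * L" "t + of_int (- \<lfloor>t / L\<rfloor>) * L < L"
    using floor_divide_bounds[OF assms, of t] by (simp_all add: algebra_simps)
qed

lemma AE_periodic:
  fixes \<Phi> :: "real \<Rightarrow> bool"
  assumes L: "0 < L" and per: "periodic L \<Phi>"
    and ae: "AE t in lborel. 0 < t \<longrightarrow> t < L \<longrightarrow> \<Phi> t"
  shows "AE t in lborel. \<Phi> t"
proof -
  \<comment> \<open>The hypothesis concerns an open period, so orbits through multiples of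
    \<open>L\<close> are discarded.\<close>
  have "AE t in lborel. t \<noteq> 0" by (rule AE_lborel_singleton)
  from AE_lborel_lattice[OF this, of L 0] AE_lborel_lattice[OF ae, of L 0]
  show ?thesis
  proof eventually_elim
    case (elim t)
    obtain k :: int where k: "0 \<le> t + of_int k * L" "t + of_int k * L < L"
      using exists_period_translate[OF L] .
    moreover have "t + of_int k * L \<noteq> 0" using elim(1) by simp
    ultimately have "\<Phi> (t + of_int k * L)" using elim(2) by simp
    then show ?case using periodic_int[OF per] by simp
  qed
qed

lemma set_integral_shift:
  fixes f :: "real \<Rightarrow> 'a::{banach, second_countable_topology}"
  shows "(LINT t:{a..b}|lborel. f (t + c)) = (LINT t:{a+c..b+c}|lborel. f t)"
  unfolding set_lebesgue_integral_def
  by (subst (2) lborel_integral_real_affine[where c=1 and t=c])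
    (auto intro!: Bochner_Integration.integral_cong simp: indicator_def add.commute)

lemma set_integral_combine:
  fixes f :: "real \<Rightarrow> 'a::{banach, second_countable_topology}"
  assumes "a \<le> b" "b \<le> c" "\<And>a b. set_integrable lborel {a..b} f"
  shows "(LINT t:{a..c}|lborel. f t) = (LINT t:{a..b}|lborel. f t) + (LINT t:{b..c}|lborel. f t)"
proof -
  have "{a..c} = {a..b} \<union> {b..c}" using assms by auto
  moreover have "AE t in lborel. \<not> (t \<in> {a..b} \<and> t \<in> {b..c})"
    using AE_lborel_singleton[of b] by eventually_elim auto
  ultimately show ?thesis
    using assms by (simp add: set_integral_Un_AE)
qed

lemma set_integral_periodic_shift:
  fixes f :: "real \<Rightarrow> 'a::{banach, second_countable_topology}"
  assumes L: "0 < L" and per: "periodic L f" and int: "\<And>a b. set_integrable lborel {a..b} f"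
  shows "(LINT t:{0..L}|lborel. f (t + h)) = (LINT t:{0..L}|lborel. f t)"
proof -
  obtain k :: int where k: "0 \<le> h + of_int k * L" "h + of_int k * L < L"
    using exists_period_translate[OF L] .
  define g where "g = h + of_int k * L"
  have sh: "(LINT t:{a..b}|lborel. f t) = (LINT t:{a + of_int k * L..b + of_int k * L}|lborel. f t)" for a b k
    by (subst set_integral_shift[symmetric]) (simp add: periodic_int[OF per])
  have "(LINT t:{0..L}|lborel. f (t + h)) = (LINT t:{h..L+h}|lborel. f t)"
    by (simp add: set_integral_shift)
  also have "\<dots> = (LINT t:{g..L+g}|lborel. f t)"
    by (subst sh[of _ _ k]) (simp add: g_def algebra_simps)
  \<comment> \<open>With \<open>h\<close> reduced modulo \<open>L\<close> to \<open>g\<close>, the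
    part beyond \<open>L\<close> is moved back by one period and fills
    \<open>{0..g}\<close>.\<close>
  also have "\<dots> = (LINT t:{g..L}|lborel. f t) + (LINT t:{L..L+g}|lborel. f t)"
    using k by (intro set_integral_combine int) (auto simp: g_def)
  also have "(LINT t:{L..L+g}|lborel. f t) = (LINT t:{0..g}|lborel. f t)"
    by (subst (2) sh[of _ _ 1]) (simp add: add.commute)
  also have "(LINT t:{g..L}|lborel. f t) + \<dots> = (LINT t:{0..L}|lborel. f t)"
    using k set_integral_combine[of 0 g L f, OF _ _ int] by (simp add: g_def)
  finally show ?thesis .
qed

lemma L2loc_periodic:
  fixes f :: "real \<Rightarrow> 'a::euclidean_space"
  assumes L: "0 < L" and per: "periodic L f" and [measurable]: "f \<in> borel_measurable borel"
    and int: "set_integrable lborel {0..L} (\<lambda>t. (norm (f t))\<^sup>2)"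
  shows "L2loc f"
  unfolding L2loc_def
proof (intro conjI allI)
  have sh: "set_integrable lborel {of_int k * L..of_int k * L + L} (\<lambda>t. (norm (f t))\<^sup>2)" for k :: int
  proof -
    have "integrable lborel (\<lambda>t. indicat_real {0..L} (of_int (-k) * L + 1 * t) *\<^sub>R (norm (f (of_int (-k) * L + 1 * t)))\<^sup>2)"
      using int unfolding set_integrable_def
      by (intro lborel_integrable_real_affine) auto
    also have "(\<lambda>t. indicat_real {0..L} (of_int (-k) * L + 1 * t) *\<^sub>R (norm (f (of_int (-k) * L + 1 * t)))\<^sup>2)
       = (\<lambda>t. indicat_real {of_int k * L..of_int k * L + L} t *\<^sub>R (norm (f t))\<^sup>2)"
      using periodic_int[OF per, of _ "-k"] by (auto simp: fun_eq_iff indicator_def add.commute)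
    finally show ?thesis unfolding set_integrable_def .
  qed
  fix a b :: real
  define K where "K = {\<lfloor>a / L\<rfloor>..\<lfloor>b / L\<rfloor>}"
  have "set_integrable lborel (\<Union>k\<in>K. {of_int k * L..of_int k * L + L}) (\<lambda>t. (norm (f t))\<^sup>2)"
    by (rule set_integrable_UN) (auto simp: K_def sh)
  moreover have "{a..b} \<subseteq> (\<Union>k\<in>K. {of_int k * L..of_int k * L + L})"
  proof
    fix t assume t: "t \<in> {a..b}"
    have "\<lfloor>t / L\<rfloor> \<in> K" using t L by (auto simp: K_def intro!: floor_mono divide_right_mono)
    moreover have "t \<in> {of_int \<lfloor>t / L\<rfloor> * L..of_int \<lfloor>t / L\<rfloor> * L + L}"
      using floor_divide_bounds[OF L, of t] by simp
    ultimately show "t \<in> (\<Union>k\<in>K. {of_int k * L..of_int k * L + L})" by blast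
  qed
  ultimately show "set_integrable lborel {a..b} (\<lambda>t. (norm (f t))\<^sup>2)"
    by - (erule set_integrable_subset, simp_all only: atLeastAtMost_borel sets_lborel)
qed simp

text \<open>Cauchy-Schwarz for the weights \<open>cmod \<kappa> ^ j\<close> of total mass
  \<open>1 / (1 - cmod \<kappa>)\<close>, each split into two square roots. Convergence follows by
  comparison, using \<open>x \<le> 1 + x\<^sup>2\<close>.\<close>

lemma cauchy_schwarz_geometric:
  fixes a :: "nat \<Rightarrow> complex" and \<kappa> :: complex
  assumes r: "cmod \<kappa> < 1" and sm: "summable (\<lambda>j. cmod \<kappa> ^ j * (cmod (a j))\<^sup>2)"
  shows "summable (\<lambda>j. \<kappa> ^ j * a j)"
    and "(cmod (\<Sum>j. \<kappa> ^ j * a j))\<^sup>2 \<le> 1 / (1 - cmod \<kappa>) * (\<Sum>j. cmod \<kappa> ^ j * (cmod (a j))\<^sup>2)"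
proof -
  let ?r = "cmod \<kappa>"
  have geo: "summable (\<lambda>j. ?r ^ j)" using r by (simp add: summable_geometric)
  have le: "x \<le> 1 + x\<^sup>2" for x :: real
    using zero_le_power2[of "x - 1/2"] by (simp add: power2_eq_square algebra_simps)
  have "summable (\<lambda>j. ?r ^ j + ?r ^ j * (cmod (a j))\<^sup>2)"
    using geo sm by (rule summable_add)
  then show summ: "summable (\<lambda>j. \<kappa> ^ j * a j)"
  proof (rule summable_comparison_test[rotated], intro exI allI impI)
    fix j
    have "?r ^ j * cmod (a j) \<le> ?r ^ j * (1 + (cmod (a j))\<^sup>2)"
      by (intro mult_left_mono le) simp
    then show "cmod (\<kappa> ^ j * a j) \<le> ?r ^ j + ?r ^ j * (cmod (a j))\<^sup>2"
      by (simp add: norm_mult norm_power algebra_simps)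
  qed
  have part: "(cmod (\<Sum>j<n. \<kappa> ^ j * a j))\<^sup>2 \<le> 1 / (1 - ?r) * (\<Sum>j. ?r ^ j * (cmod (a j))\<^sup>2)" for n
  proof -
    have s: "sqrt (?r ^ j) * sqrt (?r ^ j) = ?r ^ j" for j
      by simp
    have "cmod (\<Sum>j<n. \<kappa> ^ j * a j) \<le> (\<Sum>j<n. sqrt (?r ^ j) * (sqrt (?r ^ j) * cmod (a j)))"
      by (rule order_trans[OF norm_sum]) (simp add: norm_mult norm_power mult.assoc[symmetric])
    then have "(cmod (\<Sum>j<n. \<kappa> ^ j * a j))\<^sup>2 \<le> (\<Sum>j<n. sqrt (?r ^ j) * (sqrt (?r ^ j) * cmod (a j)))\<^sup>2"
      by (intro power_mono) auto
    also have "\<dots> \<le> (\<Sum>j<n. (sqrt (?r ^ j))\<^sup>2) * (\<Sum>j<n. (sqrt (?r ^ j) * cmod (a j))\<^sup>2)"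
      by (rule Cauchy_Schwarz_ineq_sum)
    also have "\<dots> = (\<Sum>j<n. ?r ^ j) * (\<Sum>j<n. ?r ^ j * (cmod (a j))\<^sup>2)"
      by (simp add: power_mult_distrib)
    also have "\<dots> \<le> (\<Sum>j. ?r ^ j) * (\<Sum>j. ?r ^ j * (cmod (a j))\<^sup>2)"
      by (intro mult_mono sum_le_suminf geo sm suminf_nonneg sum_nonneg) auto
    also have "(\<Sum>j. ?r ^ j) = 1 / (1 - ?r)" using r by (simp add: suminf_geometric)
    finally show ?thesis .
  qed
  have "(\<lambda>n. (cmod (\<Sum>j<n. \<kappa> ^ j * a j))\<^sup>2) \<longlonglongrightarrow> (cmod (\<Sum>j. \<kappa> ^ j * a j))\<^sup>2"
    by (intro tendsto_intros summable_LIMSEQ summ)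
  then show "(cmod (\<Sum>j. \<kappa> ^ j * a j))\<^sup>2 \<le> 1 / (1 - ?r) * (\<Sum>j. ?r ^ j * (cmod (a j))\<^sup>2)"
    by (rule LIMSEQ_le_const2) (use part in blast)
qed

text \<open>\<open>Q\<close> is the Neumann series, which converges almost everywhere because the weighted sum of the squares is integrable.\<close>

lemma circle_solve_contraction:
  fixes g :: "real \<Rightarrow> complex" and \<kappa> :: complex
  assumes L: "0 < L" and g: "L2loc g" "periodic L g" and \<kappa>: "cmod \<kappa> < 1"
  obtains Q where "L2loc Q" "periodic L Q" "AE t in lborel. Q t + \<kappa> * Q (t + h) = g t"
proof -
  note [measurable] = L2loc_measurable[OF g(1)]
  let ?r = "cmod \<kappa>"
  \<comment> \<open>Translation preserves integrals over a period, so \<open>v j\<close> has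
    integral \<open>cmod \<kappa> ^ j * E\<close> over \<open>{0..L}\<close>; hence \<open>W\<close>
    has finite integral and is finite almost everywhere.\<close>
  define v where "v = (\<lambda>(j::nat) t. ?r ^ j * (cmod (g (t + of_nat j * h)))\<^sup>2)"
  define E where "E = (LINT t:{0..L}|lborel. (cmod (g t))\<^sup>2)"
  define W where "W = (\<lambda>t. \<Sum>j. ennreal (indicator {0..L} t * v j t))"
  define Q where "Q = (\<lambda>t. \<Sum>j. (- \<kappa>) ^ j * g (t + of_nat j * h))"
  have pg: "periodic L (\<lambda>t. (cmod (g t))\<^sup>2)" using g(2) by (simp add: periodic_def)
  have vint: "set_integrable lborel {0..L} (v j)" for j
    unfolding v_def by (intro set_integrable_mult_right L2loc_integrable L2loc_shift g)
  have vE: "(LINT t:{0..L}|lborel. v j t) = ?r ^ j * E" for j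
    unfolding v_def E_def
    by (simp add: set_integral_periodic_shift[OF L pg L2loc_integrable[OF g(1)]])
  have "(\<integral>\<^sup>+t. W t \<partial>lborel) = (\<Sum>j. \<integral>\<^sup>+t. ennreal (indicator {0..L} t * v j t) \<partial>lborel)"
    unfolding W_def v_def by (subst nn_integral_suminf) auto
  also have "\<dots> = (\<Sum>j. ennreal (?r ^ j * E))"
  proof (rule arg_cong[where f=suminf], rule ext)
    fix j
    show "(\<integral>\<^sup>+t. ennreal (indicator {0..L} t * v j t) \<partial>lborel) = ennreal (?r ^ j * E)"
      using vint[of j] vE[of j] unfolding set_integrable_def set_lebesgue_integral_def real_scaleR_def
      by (subst nn_integral_eq_integral) (auto simp: v_def)
  qed
  also have "\<dots> = ennreal (\<Sum>j. ?r ^ j * E)"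
  proof (rule suminf_ennreal2)
    show "0 \<le> ?r ^ j * E" for j
      unfolding E_def set_lebesgue_integral_def
      by (intro mult_nonneg_nonneg Bochner_Integration.integral_nonneg) auto
    show "summable (\<lambda>j. ?r ^ j * E)"
      using \<kappa> by (intro summable_mult2 summable_geometric) simp
  qed
  finally have Wfin: "(\<integral>\<^sup>+t. W t \<partial>lborel) \<noteq> \<infinity>" by simp
  have Wm [measurable]: "W \<in> borel_measurable borel" unfolding W_def v_def by measurable
  have "AE t in lborel. W t \<noteq> \<infinity>"
    by (rule nn_integral_PInf_AE[OF _ Wfin]) simp
  then have good0: "AE t in lborel. 0 < t \<longrightarrow> t < L \<longrightarrow> summable (\<lambda>j. v j t)"
  proof eventually_elim
    case (elim t)
    show ?case
    proof (intro impI)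
      assume "0 < t" "t < L"
      then have "(\<Sum>j. ennreal (v j t)) \<noteq> top" using elim by (simp add: W_def)
      then show "summable (\<lambda>j. v j t)"
        by (rule summable_suminf_not_top[rotated]) (simp add: v_def)
    qed
  qed
  have gp: "g (t + L + of_nat j * h) = g (t + of_nat j * h)" for t j
    using g(2) unfolding periodic_def by (metis add.commute add.left_commute)
  then have "periodic L (\<lambda>t. summable (\<lambda>j. v j t))"
    by (simp add: periodic_def v_def)
  then have good: "AE t in lborel. summable (\<lambda>j. v j t)"
    by (rule AE_periodic[OF L _ good0])
  have Qm [measurable]: "Q \<in> borel_measurable borel" unfolding Q_def by measurable
  have Qp: "periodic L Q" unfolding Q_def periodic_def by (simp add: gp)
  have le: "AE t in lborel. ennreal (norm (indicator {0..L} t *\<^sub>R (norm (Q t))\<^sup>2)) \<le> ennreal (1 / (1 - ?r)) * W t"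
    using good
  proof eventually_elim
    case (elim t)
    have "(cmod (Q t))\<^sup>2 \<le> 1 / (1 - ?r) * (\<Sum>j. v j t)"
      using cauchy_schwarz_geometric(2)[of "- \<kappa>" "\<lambda>j. g (t + of_nat j * h)"] elim \<kappa>
      by (simp add: v_def Q_def)
    moreover have "t \<in> {0..L} \<Longrightarrow> W t = ennreal (\<Sum>j. v j t)"
      using elim unfolding W_def by (simp add: suminf_ennreal2 v_def)
    moreover have "0 \<le> (\<Sum>j. v j t)" using elim by (intro suminf_nonneg) (auto simp: v_def)
    ultimately show ?case
      using \<kappa> by (cases "t \<in> {0..L}") (auto simp: ennreal_mult[symmetric] intro!: ennreal_leI)
  qed
  have "set_integrable lborel {0..L} (\<lambda>t. (norm (Q t))\<^sup>2)"
    unfolding set_integrable_def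
  proof (rule integrableI_bounded)
    have "(\<integral>\<^sup>+t. ennreal (norm (indicator {0..L} t *\<^sub>R (norm (Q t))\<^sup>2)) \<partial>lborel)
        \<le> (\<integral>\<^sup>+t. ennreal (1 / (1 - ?r)) * W t \<partial>lborel)"
      by (rule nn_integral_mono_AE[OF le])
    also have "\<dots> < \<infinity>"
      using Wfin by (simp add: nn_integral_cmult ennreal_mult_less_top top.not_eq_extremum)
    finally show "(\<integral>\<^sup>+t. ennreal (norm (indicator {0..L} t *\<^sub>R (norm (Q t))\<^sup>2)) \<partial>lborel) < \<infinity>" .
  qed simp
  then have "L2loc Q" by (intro L2loc_periodic[OF L Qp]) auto
  \<comment> \<open>Splitting off the first term of the series at \<open>t\<close> leaves
    \<open>- \<kappa>\<close> times the series at \<open>t + h\<close>, so convergence is required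
    at both points.\<close>
  moreover have "AE t in lborel. Q t + \<kappa> * Q (t + h) = g t"
    using good AE_lborel_shift[OF good, of h]
  proof eventually_elim
    case (elim t)
    have s1: "summable (\<lambda>j. (- \<kappa>) ^ j * g (t + of_nat j * h))"
      using cauchy_schwarz_geometric(1)[of "- \<kappa>" "\<lambda>j. g (t + of_nat j * h)"] elim(1) \<kappa>
      by (simp add: v_def)
    have s2: "summable (\<lambda>j. (- \<kappa>) ^ j * g (t + h + of_nat j * h))"
      using cauchy_schwarz_geometric(1)[of "- \<kappa>" "\<lambda>j. g (t + h + of_nat j * h)"] elim(2) \<kappa>
      by (simp add: v_def)
    have "Q t = g t + (\<Sum>j. (- \<kappa>) ^ Suc j * g (t + of_nat (Suc j) * h))"
      unfolding Q_def using suminf_split_head[OF s1] by simp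
    also have "(\<Sum>j. (- \<kappa>) ^ Suc j * g (t + of_nat (Suc j) * h))
        = (\<Sum>j. (- \<kappa>) * ((- \<kappa>) ^ j * g (t + h + of_nat j * h)))"
      by (simp add: algebra_simps)
    also have "\<dots> = - \<kappa> * Q (t + h)"
      unfolding Q_def by (rule suminf_mult[OF s2])
    finally show ?case by simp
  qed
  ultimately show ?thesis using Qp that by blast
qed

text \<open>On \<open>L\<close>-periodic functions translation by \<open>b * h\<close> is the
  identity, so a geometric sum of \<open>b\<close> terms telescopes and inverts the operator up to
  the factor \<open>1 - (- \<kappa>) ^ b\<close>.\<close>

lemma circle_solve_rational:
  fixes g :: "real \<Rightarrow> complex" and \<kappa> :: complex
  assumes g: "L2loc g" "periodic L g" and b: "of_nat b * h = of_int a * L" "(- \<kappa>) ^ b \<noteq> 1"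
  obtains Q where "L2loc Q" "periodic L Q" "\<And>t. Q t + \<kappa> * Q (t + h) = g t"
proof
  define u where "u = (\<lambda>(j::nat) t. (- \<kappa>) ^ j * g (t + of_nat j * h))"
  define c where "c = 1 / (1 - (- \<kappa>) ^ b)"
  define Q where "Q = (\<lambda>t. c * (\<Sum>j<b. u j t))"
  show "L2loc Q" unfolding Q_def u_def
    by (intro L2loc_cmult L2loc_sum L2loc_shift g) simp
  have gp: "g (t + L + of_nat j * h) = g (t + of_nat j * h)" for t j
    using g(2) unfolding periodic_def by (metis add.commute add.left_commute)
  then show "periodic L Q" by (simp add: Q_def periodic_def u_def)
  fix t
  have "\<kappa> * u j (t + h) = - u (Suc j) t" for j
    by (simp add: u_def algebra_simps)
  then have "(\<Sum>j<b. u j t - u (Suc j) t) = (\<Sum>j<b. u j t + \<kappa> * u j (t + h))"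
    by simp
  then have "Q t + \<kappa> * Q (t + h) = c * (\<Sum>j<b. u j t - u (Suc j) t)"
    by (simp add: Q_def sum.distrib sum_distrib_left[symmetric] distrib_left mult.left_commute)
  also have "(\<Sum>j<b. u j t - u (Suc j) t) = u 0 t - u b t"
    by (rule sum_lessThan_telescope')
  also have "u b t = (- \<kappa>) ^ b * g t"
    using periodic_int[OF g(2), of t a] b(1) by (simp add: u_def)
  finally have "Q t + \<kappa> * Q (t + h) = c * (1 - (- \<kappa>) ^ b) * g t"
    by (simp add: u_def algebra_simps)
  then show "Q t + \<kappa> * Q (t + h) = g t"
    using b(2) by (simp add: c_def)
qed

text \<open>Equivalently, \<open>-\<rho>\<close> is not in the spectrum on \<open>L\<^sup>2\<close> of the translation \<open>Q \<mapsto> Q(\<cdot> - h)\<close>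
  of the circle of length \<open>L\<close>. For \<open>b = 0\<close> the second alternative is false.\<close>

definition nonresonant :: "real \<Rightarrow> real \<Rightarrow> complex \<Rightarrow> bool" where
  "nonresonant L h \<rho> \<longleftrightarrow> cmod \<rho> \<noteq> 1 \<or>
     (\<exists>(b::nat) (a::int). of_nat b * h = of_int a * L \<and> (- \<rho>) ^ b \<noteq> 1)"

text \<open>For \<open>cmod \<rho> < 1\<close> translate the equation by \<open>h\<close> and use
  the Neumann series; for \<open>cmod \<rho> > 1\<close> divide by \<open>\<rho>\<close> and use the
  series in the opposite direction; otherwise the rotation has finite order.\<close>

lemma circle_solve:
  fixes g :: "real \<Rightarrow> complex"
  assumes L: "0 < L" and nr: "nonresonant L h \<rho>" and g: "L2loc g" "periodic L g"
  obtains Q where "L2loc Q" "periodic L Q" "AE t in lborel. Q (t - h) + \<rho> * Q t = g t"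
proof -
  have gs: "L2loc (\<lambda>t. g (t + h))" "periodic L (\<lambda>t. g (t + h))"
    using g by (auto intro: L2loc_shift periodic_shift)
  note fin = that
  have *: thesis if Q: "L2loc Q" "periodic L Q" "AE t in lborel. Q t + \<rho> * Q (t + h) = g (t + h)" for Q
    using AE_lborel_shift[OF Q(3), of "- h"] fin[of Q] Q by simp
  consider "cmod \<rho> < 1" | "1 < cmod \<rho>"
    | "\<exists>(b::nat) (a::int). of_nat b * h = of_int a * L \<and> (- \<rho>) ^ b \<noteq> 1"
    using nr unfolding nonresonant_def by fastforce
  then show thesis
  proof cases
    case 1
    show thesis by (rule circle_solve_contraction[OF L gs 1, of h]) (rule *)
  next
    case 2
    have nz: "\<rho> \<noteq> 0" using 2 by auto
    have "cmod (inverse \<rho>) < 1" using 2 by (simp add: norm_inverse inverse_less_1_iff)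
    moreover have "L2loc (\<lambda>t. inverse \<rho> * g t)" "periodic L (\<lambda>t. inverse \<rho> * g t)"
      using g by (auto intro: L2loc_cmult simp: periodic_def)
    ultimately obtain Q where Q: "L2loc Q" "periodic L Q"
      "AE t in lborel. Q t + inverse \<rho> * Q (t + - h) = inverse \<rho> * g t"
      using circle_solve_contraction[OF L, of "\<lambda>t. inverse \<rho> * g t" "inverse \<rho>" "- h"] by blast
    have "AE t in lborel. Q (t - h) + \<rho> * Q t = g t"
      using Q(3) by eventually_elim (use nz in \<open>simp add: field_simps\<close>)
    then show thesis using Q that by blast
  next
    case 3
    then obtain b :: nat and a :: int where ba: "of_nat b * h = of_int a * L" "(- \<rho>) ^ b \<noteq> 1"
      by blast
    show thesis by (rule circle_solve_rational[OF gs ba]) (rule *, auto)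
  qed
qed

text \<open>Translation preserves the energy over a period, which settles
  \<open>cmod \<rho> \<noteq> 1\<close>. On the unit circle, \<open>b\<close> iterations lead back
  to the same point of the circle with the factor \<open>(- \<rho>) ^ b \<noteq> 1\<close>.\<close>

lemma circle_unique:
  fixes Q :: "real \<Rightarrow> complex"
  assumes L: "0 < L" and nr: "nonresonant L h \<rho>" and Q: "L2loc Q" "periodic L Q"
    and eq: "AE t in lborel. Q (t - h) + \<rho> * Q t = 0"
  shows "AE t in lborel. Q t = 0"
proof (cases "cmod \<rho> = 1")
  case False
  note [measurable] = L2loc_measurable[OF Q(1)]
  define I where "I = (LINT t:{0..L}|lborel. (cmod (Q t))\<^sup>2)"
  have p: "periodic L (\<lambda>t. (cmod (Q t))\<^sup>2)" using Q(2) by (simp add: periodic_def)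
  have "AE t in lborel. (cmod (Q (t + - h)))\<^sup>2 = (cmod \<rho>)\<^sup>2 * (cmod (Q t))\<^sup>2"
    using eq
  proof eventually_elim
    case (elim t)
    then have "Q (t + - h) = - (\<rho> * Q t)" by (simp add: add_eq_0_iff2)
    then show ?case by (simp add: norm_mult power_mult_distrib)
  qed
  then have "(LINT t:{0..L}|lborel. (cmod (Q (t + - h)))\<^sup>2) = (LINT t:{0..L}|lborel. (cmod \<rho>)\<^sup>2 * (cmod (Q t))\<^sup>2)"
    unfolding set_lebesgue_integral_def
    by (intro integral_cong_AE) (auto elim!: eventually_mono)
  then have "I = (cmod \<rho>)\<^sup>2 * I"
    unfolding I_def set_integral_periodic_shift[OF L p L2loc_integrable[OF Q(1)]] by simp
  moreover have "(cmod \<rho>)\<^sup>2 \<noteq> 1" using False norm_ge_zero[of \<rho>] by (smt (verit) power2_eq_1_iff)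
  ultimately have "I = 0" by simp
  then have "AE t in lborel. indicator {0..L} t *\<^sub>R (cmod (Q t))\<^sup>2 = 0"
    using L2loc_integrable[OF Q(1), of 0 L]
    unfolding I_def set_lebesgue_integral_def set_integrable_def
    by (subst (asm) integral_nonneg_eq_0_iff_AE) auto
  then have "AE t in lborel. 0 < t \<longrightarrow> t < L \<longrightarrow> Q t = 0"
    by eventually_elim auto
  moreover have "periodic L (\<lambda>t. Q t = 0)" using Q(2) by (simp add: periodic_def)
  ultimately show ?thesis by (rule AE_periodic[OF L, rotated])
next
  case True
  then obtain b :: nat and a :: int where ba: "of_nat b * h = of_int a * L" "(- \<rho>) ^ b \<noteq> 1"
    using nr unfolding nonresonant_def by blast
  from AE_lborel_lattice[OF eq, of h 0] show ?thesis
  proof eventually_elim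
    case (elim t)
    have "Q (t - of_nat j * h) = (- \<rho>) ^ j * Q t" for j :: nat
    proof (induction j)
      case (Suc j)
      have "Q (t + of_int (- int j) * h - h) + \<rho> * Q (t + of_int (- int j) * h) = 0"
        using elim[THEN spec, of "- int j"] by simp
      then have "Q (t - of_nat (Suc j) * h) = - \<rho> * Q (t - of_nat j * h)"
        by (simp add: algebra_simps add_eq_0_iff)
      then show ?case using Suc by simp
    qed simp
    from this[of b] have "Q (t + of_int (- a) * L) = (- \<rho>) ^ b * Q t"
      using ba(1) by simp
    then have "(1 - (- \<rho>) ^ b) * Q t = 0"
      using periodic_int[OF Q(2), of t "- a"] by (simp add: algebra_simps)
    then show ?case using ba(2) by simp
  qed
qed

section \<open>Fourier coefficients and resonance\<close>

lemma L2loc_set_integrable: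
  assumes f: "L2loc f"
  shows "set_integrable lborel {a..b} f"
proof -
  note [measurable] = L2loc_measurable[OF f]
  have le: "x \<le> 1 + x\<^sup>2" for x :: real
    using zero_le_power2[of "x - 1/2"] by (simp add: power2_eq_square algebra_simps)
  have "set_integrable lborel {a..b} (\<lambda>t. 1 + (norm (f t))\<^sup>2)"
    by (intro set_integral_add(1) L2loc_integrable f borel_integrable_atLeastAtMost') auto
  then show ?thesis
    by (rule set_integrable_bound) (auto simp: set_borel_measurable_def le)
qed

definition character :: "real \<Rightarrow> int \<Rightarrow> real \<Rightarrow> complex" where
  "character L n t = cis (2 * pi * of_int n * t / L)"

text \<open>Not divided by the period: the component of \<open>f\<close> along a character is the
  coefficient divided by \<open>L\<close>.\<close>

definition fourier_coeff :: "real \<Rightarrow> (real \<Rightarrow> complex) \<Rightarrow> int \<Rightarrow> complex" where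
  "fourier_coeff L f n = (LINT t:{0..L}|lborel. character L (- n) t * f t)"

lemma character_add: "character L n (s + t) = character L n s * character L n t"
  by (simp add: character_def cis_mult algebra_simps add_divide_distrib)

lemma character_mult: "character L m t * character L n t = character L (m + n) t"
  by (simp add: character_def cis_mult algebra_simps add_divide_distrib)

lemma norm_character [simp]: "norm (character L n t) = 1"
  by (simp add: character_def)

lemma cnj_character: "cnj (character L n t) = character L (- n) t"
  by (simp add: character_def cis_cnj)

lemma character_period: "0 < L \<Longrightarrow> character L n L = 1"
  by (simp add: character_def cis_multiple_2pi)

lemma continuous_character: "continuous_on UNIV (character L n)"
  unfolding character_def cis_conv_exp divide_inverse by (intro continuous_intros)

lemma L2loc_character_mult: "L2loc f \<Longrightarrow> L2loc (\<lambda>t. character L n t * f t)"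
  by (rule L2loc_cont_mult[OF continuous_character])

lemma character_conv_exp: "character L n t = exp (2 * pi * \<i> * of_int n / L * t)"
  by (simp add: character_def cis_conv_exp algebra_simps)

lemma integral_exp_period:
  fixes a :: complex
  assumes L: "0 \<le> L" and a: "a \<noteq> 0"
  shows "(LINT t:{0..L}|lborel. exp (a * of_real t)) = (exp (a * of_real L) - 1) / a"
proof -
  have "(LINT t:{0..L}|lborel. exp (a * of_real t)) = exp (a * of_real L) / a - exp (a * of_real 0) / a"
    unfolding set_lebesgue_integral_def
  proof (rule integral_FTC_atLeastAtMost[OF L])
    show "((\<lambda>t. exp (a * complex_of_real t) / a) has_vector_derivative exp (a * complex_of_real t)) (at t within {0..L})" for t
      using a by (intro derivative_eq_intros has_complex_derivative_imp_has_vector_derivative[unfolded o_def] | simp)+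
    show "continuous_on {0..L} (\<lambda>t. exp (a * complex_of_real t))"
      by (intro continuous_intros)
  qed
  then show ?thesis by (simp add: diff_divide_distrib)
qed

lemma integral_id_exp_period:
  fixes a :: complex
  assumes L: "0 \<le> L" and a: "a \<noteq> 0" and per: "exp (a * of_real L) = 1"
  shows "(LINT t:{0..L}|lborel. of_real t * exp (a * of_real t)) = of_real L / a"
proof -
  \<comment> \<open>\<open>?F\<close> comes from integration by parts; its terms in
    \<open>1 / a\<^sup>2\<close> cancel between the two ends by periodicity.\<close>
  let ?F = "\<lambda>t. (of_real t / a - 1 / a\<^sup>2) * exp (a * complex_of_real t)"
  have "(LINT t:{0..L}|lborel. of_real t * exp (a * of_real t)) = ?F L - ?F 0"
    unfolding set_lebesgue_integral_def
  proof (rule integral_FTC_atLeastAtMost[OF L])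
    have "((\<lambda>z. (z / a - 1 / a\<^sup>2) * exp (a * z)) has_field_derivative z * exp (a * z)) (at z)" for z :: complex
    proof -
      have "((\<lambda>z. z / a - 1 / a\<^sup>2) has_field_derivative 1 / a - 0) (at z)"
        by (intro DERIV_diff DERIV_cdivide DERIV_ident DERIV_const)
      moreover have "((\<lambda>z. exp (a * z)) has_field_derivative exp (a * z) * (a * 1)) (at z)"
        by (intro DERIV_fun_exp DERIV_cmult DERIV_ident)
      ultimately have "((\<lambda>z. (z / a - 1 / a\<^sup>2) * exp (a * z)) has_field_derivative
          (1 / a - 0) * exp (a * z) + exp (a * z) * (a * 1) * (z / a - 1 / a\<^sup>2)) (at z)"
        by (rule DERIV_mult)
      also have "(1 / a - 0) * exp (a * z) + exp (a * z) * (a * 1) * (z / a - 1 / a\<^sup>2)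
          = exp (a * z) * (1 / a + a * (z / a) - a * (1 / a\<^sup>2))"
        by (simp add: algebra_simps)
      also have "\<dots> = z * exp (a * z)"
        using a by (simp add: power2_eq_square)
      finally show ?thesis .
    qed
    from has_field_derivative_at_within[OF this]
    show "(?F has_vector_derivative of_real t * exp (a * complex_of_real t)) (at t within {0..L})" for t
      using has_complex_derivative_imp_has_vector_derivative
        [of "\<lambda>z. (z / a - 1 / a\<^sup>2) * exp (a * z)" "of_real t * exp (a * of_real t)" t 0 L]
      by (simp add: o_def)
    show "continuous_on {0..L} (\<lambda>t. of_real t * exp (a * complex_of_real t))"
      by (intro continuous_intros)
  qed
  also have "\<dots> = of_real L / a" by (simp add: per)
  finally show ?thesis .
qed

lemma integral_character:
  assumes L: "0 < L"
  shows "(LINT t:{0..L}|lborel. character L n t) = (if n = 0 then of_real L else 0)"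
proof (cases "n = 0")
  case True
  then show ?thesis using L by (simp add: character_def set_lebesgue_integral_def scaleR_conv_of_real)
next
  case False
  define a where "a = 2 * pi * \<i> * of_int n / complex_of_real L"
  have a: "a \<noteq> 0" using False L by (simp add: a_def)
  have "(LINT t:{0..L}|lborel. character L n t) = (exp (a * of_real L) - 1) / a"
    using integral_exp_period[of L a] L a by (simp add: character_conv_exp a_def)
  also have "exp (a * of_real L) = 1"
    using character_period[OF L, of n] by (simp add: character_conv_exp a_def)
  finally show ?thesis using False by simp
qed

text \<open>One step of Bessel's inequality: \<open>G\<close> is \<open>F\<close> without its
  component along the character \<open>m\<close>, and the claims are the orthogonality of the
  characters and Pythagoras.\<close>

lemma bessel_step:
  fixes F :: "real \<Rightarrow> complex" and m k :: int
  assumes L: "0 < L" and F: "L2loc F"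
  defines "G \<equiv> (\<lambda>t. F t - fourier_coeff L F m / of_real L * character L m t)"
  shows "L2loc G"
    and "k \<noteq> m \<Longrightarrow> fourier_coeff L G k = fourier_coeff L F k"
    and "(LINT t:{0..L}|lborel. (cmod (G t))\<^sup>2)
      = (LINT t:{0..L}|lborel. (cmod (F t))\<^sup>2) - (cmod (fourier_coeff L F m))\<^sup>2 / L"
proof -
  define a where "a = fourier_coeff L F m / of_real L"
  have ch: "L2loc (\<lambda>t. a * character L m t)"
    using L2loc_cmult[OF L2loc_character_mult[OF L2loc_const[of 1]]] by simp
  then show "L2loc G" unfolding G_def a_def[symmetric] by (intro L2loc_diff F)
  have si: "set_integrable lborel {0..L} (\<lambda>t. character L k t * F t)" for k
    by (intro L2loc_set_integrable L2loc_character_mult F)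
  have sic: "set_integrable lborel {0..L} (character L k)" for k
    by (intro borel_integrable_atLeastAtMost' continuous_on_subset[OF continuous_character]) auto
  show "fourier_coeff L G k = fourier_coeff L F k" if "k \<noteq> m"
  proof -
    have "character L (- k) t * (F t - a * character L m t)
        = character L (- k) t * F t - a * character L (m - k) t" for t
      using character_mult[of L "- k" t m] by (simp add: algebra_simps)
    then have "fourier_coeff L G k = (LINT t:{0..L}|lborel. character L (- k) t * F t - a * character L (m - k) t)"
      unfolding G_def a_def[symmetric] fourier_coeff_def[of L "\<lambda>t. F t - a * character L m t"]
      by simp
    also have "\<dots> = fourier_coeff L F k - a * (LINT t:{0..L}|lborel. character L (m - k) t)"
      unfolding fourier_coeff_def
      by (subst set_integral_diff(2)[OF si]) (auto intro: sic)
    finally show ?thesis using that by (simp add: integral_character[OF L])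
  qed
  have sq: "(cmod (G t))\<^sup>2 = (cmod (F t))\<^sup>2 - 2 * Re (cnj a * (character L (- m) t * F t)) + (cmod a)\<^sup>2" for t
  proof -
    have "(cmod (x - y))\<^sup>2 = (cmod x)\<^sup>2 - 2 * Re (cnj y * x) + (cmod y)\<^sup>2" for x y :: complex
      unfolding cmod_power2 by (simp add: power2_eq_square algebra_simps)
    from this[of "F t" "a * character L m t"] show ?thesis
      unfolding G_def a_def[symmetric] by (simp add: norm_mult cnj_character mult.assoc)
  qed
  have si': "set_integrable lborel {0..L} (\<lambda>t. 2 * Re (cnj a * (character L (- m) t * F t)))"
  proof -
    have "set_integrable lborel {0..L} (\<lambda>t. cnj a * (character L (- m) t * F t))"
      by (intro set_integrable_mult_right si)
    then have "integrable lborel (\<lambda>t. Re (indicat_real {0..L} t *\<^sub>R (cnj a * (character L (- m) t * F t))))"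
      unfolding set_integrable_def by (rule integrable_Re)
    then have "set_integrable lborel {0..L} (\<lambda>t. Re (cnj a * (character L (- m) t * F t)))"
      unfolding set_integrable_def by simp
    then show ?thesis by (intro set_integrable_mult_right)
  qed
  have re: "(LINT t:{0..L}|lborel. 2 * Re (cnj a * (character L (- m) t * F t))) = 2 * Re (cnj a * fourier_coeff L F m)"
  proof -
    have "Re (cnj a * fourier_coeff L F m) = Re (LINT t:{0..L}|lborel. cnj a * (character L (- m) t * F t))"
      unfolding fourier_coeff_def by simp
    also have "\<dots> = (LINT t:{0..L}|lborel. Re (cnj a * (character L (- m) t * F t)))"
      unfolding set_lebesgue_integral_def
      by (subst integral_Re[symmetric])
        (use set_integrable_mult_right[OF si, of "cnj a"] in \<open>auto simp: set_integrable_def\<close>)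
    finally show ?thesis by (simp only: set_integral_mult_right)
  qed
  have "(LINT t:{0..L}|lborel. (cmod (G t))\<^sup>2)
     = (LINT t:{0..L}|lborel. (cmod (F t))\<^sup>2) - 2 * Re (cnj a * fourier_coeff L F m) + L * (cmod a)\<^sup>2"
  proof -
    have "set_integrable lborel {0..L} (\<lambda>t. (cmod (F t))\<^sup>2 - 2 * Re (cnj a * (character L (- m) t * F t)))"
      by (rule set_integral_diff(1)[OF L2loc_integrable[OF F] si'])
    moreover have "set_integrable lborel {0..L} (\<lambda>t. (cmod a)\<^sup>2)"
      by (intro borel_integrable_atLeastAtMost' continuous_on_const)
    moreover have "(LINT t:{0..L}|lborel. (cmod a)\<^sup>2) = L * (cmod a)\<^sup>2"
      using L by (simp add: set_lebesgue_integral_def)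
    ultimately show ?thesis
      unfolding sq re[symmetric] set_integral_diff(2)[OF L2loc_integrable[OF F] si', symmetric]
      by (simp only: set_integral_add(2))
  qed
  also have "2 * Re (cnj a * fourier_coeff L F m) = 2 * (cmod (fourier_coeff L F m))\<^sup>2 / L"
    unfolding cmod_power2 by (simp add: a_def power2_eq_square algebra_simps add_divide_distrib)
  also have "L * (cmod a)\<^sup>2 = (cmod (fourier_coeff L F m))\<^sup>2 / L"
    using L by (simp add: a_def norm_divide power2_eq_square)
  finally show "(LINT t:{0..L}|lborel. (cmod (G t))\<^sup>2)
      = (LINT t:{0..L}|lborel. (cmod (F t))\<^sup>2) - (cmod (fourier_coeff L F m))\<^sup>2 / L"
    by simp
qed

text \<open>A form of the Riemann-Lebesgue lemma: each removed component with coefficient at least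
  \<open>c\<close> costs energy at least \<open>c\<^sup>2 / L\<close>, and the energy stays
  nonnegative.\<close>

lemma finite_large_fourier_coeffs:
  assumes L: "0 < L" and F: "L2loc F" and c: "0 < c"
  shows "finite {n. c \<le> cmod (fourier_coeff L F n)}"
proof (rule ccontr)
  assume inf: "infinite {n. c \<le> cmod (fourier_coeff L F n)}"
  \<comment> \<open>\<open>A\<close> collects the indices already removed. Outside it the
    coefficients are still those of \<open>F\<close>, so an infinite set of large ones always
    supplies another.\<close>
  have "\<exists>G A. L2loc G \<and> finite A \<and> (\<forall>k. k \<notin> A \<longrightarrow> fourier_coeff L G k = fourier_coeff L F k) \<and>
    (LINT t:{0..L}|lborel. (cmod (G t))\<^sup>2) \<le> (LINT t:{0..L}|lborel. (cmod (F t))\<^sup>2) - of_nat N * (c\<^sup>2 / L)" for N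
  proof (induction N)
    case 0
    then show ?case using F by (intro exI[of _ F] exI[of _ "{}"]) auto
  next
    case (Suc N)
    then obtain G A where G: "L2loc G" "finite A"
      "\<And>k. k \<notin> A \<Longrightarrow> fourier_coeff L G k = fourier_coeff L F k"
      "(LINT t:{0..L}|lborel. (cmod (G t))\<^sup>2) \<le> (LINT t:{0..L}|lborel. (cmod (F t))\<^sup>2) - of_nat N * (c\<^sup>2 / L)"
      by blast
    obtain m where m: "c \<le> cmod (fourier_coeff L F m)" "m \<notin> A"
      using inf G(2) by (metis (mono_tags, lifting) finite_subset mem_Collect_eq subsetI)
    have "c\<^sup>2 \<le> (cmod (fourier_coeff L G m))\<^sup>2"
      using m c by (simp add: G(3))
    then have "c\<^sup>2 / L \<le> (cmod (fourier_coeff L G m))\<^sup>2 / L"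
      using L by (intro divide_right_mono) auto
    then show ?case
      using bessel_step[OF L G(1), where m = m] G
      by (intro exI[of _ "\<lambda>t. G t - fourier_coeff L G m / of_real L * character L m t"] exI[of _ "insert m A"])
        (auto simp: distrib_right add_divide_distrib)
  qed
  moreover have "0 \<le> (LINT t:{0..L}|lborel. (cmod (G t))\<^sup>2)" for G :: "real \<Rightarrow> complex"
    unfolding set_lebesgue_integral_def by (intro Bochner_Integration.integral_nonneg) auto
  ultimately have "of_nat N * (c\<^sup>2 / L) \<le> (LINT t:{0..L}|lborel. (cmod (F t))\<^sup>2)" for N :: nat
    by (smt (verit))
  moreover have "0 < c\<^sup>2 / L" using c L by simp
  ultimately show False
    by (meson ex_less_of_nat_mult linorder_not_le)
qed

lemma fourier_coeff_shift:
  assumes L: "0 < L" and Q: "L2loc Q" "periodic L Q"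
  shows "fourier_coeff L (\<lambda>t. Q (t - h)) n = character L (- n) h * fourier_coeff L Q n"
proof -
  define f where "f = (\<lambda>t. character L (- n) t * Q t)"
  have "periodic L f"
    using Q(2) by (simp add: periodic_def f_def character_add character_period[OF L])
  moreover have "set_integrable lborel {a..b} f" for a b
    unfolding f_def by (intro L2loc_set_integrable L2loc_character_mult Q)
  ultimately have sh: "(LINT t:{0..L}|lborel. f (t + - h)) = fourier_coeff L Q n"
    using set_integral_periodic_shift[OF L, of f "- h"] by (simp add: fourier_coeff_def f_def)
  have "fourier_coeff L (\<lambda>t. Q (t - h)) n = (LINT t:{0..L}|lborel. character L (- n) h * f (t + - h))"
  proof -
    have "character L (- n) t * Q (t - h) = character L (- n) h * f (t + - h)" for t
      using character_add[of L "- n" h "t - h"] by (simp add: f_def)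
    then show ?thesis by (simp add: fourier_coeff_def)
  qed
  then show ?thesis using sh by simp
qed

text \<open>Take \<open>p / q\<close> within \<open>1 / q\<^sup>2\<close> of \<open>\<alpha>\<close>
  and \<open>r / q\<close> within \<open>1 / (2 * q)\<close> of \<open>\<eta>\<close>. Since
  \<open>p\<close> is invertible modulo \<open>q\<close>, some \<open>n\<close> with
  \<open>q \<le> n < 2 * q\<close> has \<open>n * p\<close> congruent to \<open>r\<close>, and the
  errors add up to at most \<open>5 / (2 * q)\<close>.\<close>

lemma inhomogeneous_approximation:
  fixes \<alpha> \<eta> :: real and K :: int
  assumes "\<alpha> \<notin> \<rat>"
  obtains n m :: int where "K < n" "0 < n" "\<bar>of_int n * \<alpha> - \<eta> - of_int m\<bar> \<le> 5 / of_int n"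
proof -
  have "infinite (approx_set \<alpha>)" using assms rational_iff_finite_approx_set by blast
  then obtain p q where pq: "(p, q) \<in> approx_set \<alpha>" "max K 0 < q"
    using infinite_approx_set by blast
  then have q: "0 < q" "K < q" and cop: "coprime p q"
    and ap: "\<bar>\<alpha> - of_int p / of_int q\<bar> < 1 / (of_int q)\<^sup>2"
    by (auto simp: approx_set_def)
  define r where "r = round (\<eta> * of_int q)"
  have r: "\<bar>of_int r - \<eta> * of_int q\<bar> \<le> 1 / 2"
    unfolding r_def by (rule of_int_round_abs_le)
  obtain u v where uv: "u * p + v * q = 1"
    using cop by (metis bezout_int coprime_imp_gcd_eq_1)
  \<comment> \<open>\<open>u\<close> inverts \<open>p\<close> modulo \<open>q\<close>; the summand
    \<open>q\<close> makes \<open>n\<close> as large as desired while keeping it comparable with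
    \<open>q\<close>.\<close>
  define n where "n = q + (u * r) mod q"
  have n: "q \<le> n" "n < 2 * q" using q by (auto simp: n_def)
  have "n = q + u * r - q * (u * r div q)"
    unfolding n_def by (simp add: minus_mult_div_eq_mod[symmetric])
  then have "n * p - r = (q + u * r - q * (u * r div q)) * p - r * (u * p + v * q)"
    using uv by simp
  also have "\<dots> = q * (p - (u * r div q) * p - r * v)"
    by (simp add: algebra_simps)
  finally have "q dvd n * p - r" by simp
  then obtain m where m: "n * p - r = q * m" by (elim dvdE)
  have qr: "0 < real_of_int q" using q by simp
  have e: "of_int n * \<alpha> - \<eta> - of_int m = of_int n * (\<alpha> - of_int p / of_int q) + (of_int r - \<eta> * of_int q) / of_int q"
  proof -
    have "of_int n * of_int p - of_int r = of_int q * (of_int m :: real)"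
      using m by (metis of_int_diff of_int_mult)
    then have "of_int m = (of_int n * of_int p - of_int r) / (of_int q :: real)"
      using qr by (simp add: field_simps)
    then show ?thesis
      using qr by (simp add: right_diff_distrib diff_divide_distrib)
  qed
  have "\<bar>of_int n * (\<alpha> - of_int p / of_int q)\<bar> \<le> (2 * of_int q) * (1 / (of_int q)\<^sup>2)"
    unfolding abs_mult using n q ap by (intro mult_mono) auto
  also have "\<dots> = 2 / of_int q" using qr by (simp add: power2_eq_square)
  finally have b1: "\<bar>of_int n * (\<alpha> - of_int p / of_int q)\<bar> \<le> 2 / of_int q" .
  have b2: "\<bar>(of_int r - \<eta> * of_int q) / of_int q\<bar> \<le> (1 / 2) / of_int q"
    using r qr by (simp add: abs_divide divide_right_mono del: divide_divide_eq_left)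
  have "2 / of_int q + (1 / 2) / of_int q \<le> 5 / real_of_int n"
    using n q by (simp add: field_simps)
  then have "\<bar>of_int n * \<alpha> - \<eta> - of_int m\<bar> \<le> 5 / of_int n"
    unfolding e using b1 b2 by linarith
  then show ?thesis using that[of n m] n q by simp
qed

lemma norm_cis_diff_le: "cmod (cis x - cis y) \<le> \<bar>x - y\<bar>"
proof -
  have "cis x - cis y = cis y * (exp (\<i> * of_real (x - y)) - 1)"
    by (simp add: cis_conv_exp[symmetric] right_diff_distrib cis_mult del: of_real_diff)
  then have "cmod (cis x - cis y) = 2 * \<bar>sin ((x - y) / 2)\<bar>"
    by (simp add: norm_mult dist_exp_i_1 del: of_real_diff)
  also have "\<dots> \<le> 2 * \<bar>(x - y) / 2\<bar>"
    by (intro mult_left_mono abs_sin_x_le_abs_x) simp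
  finally show ?thesis by simp
qed

text \<open>Translations are diagonal in the characters, so the equation splits into one scalar
  equation per frequency.\<close>

lemma circle_fourier_coeff:
  fixes Q :: "real \<Rightarrow> complex"
  assumes L: "0 < L" and Q: "L2loc Q" "periodic L Q" and [measurable]: "g \<in> borel_measurable borel"
    and eq: "AE t in lborel. 0 < t \<longrightarrow> t < L \<longrightarrow> Q (t - h) + \<rho> * Q t = g t"
  shows "(character L (- n) h + \<rho>) * fourier_coeff L Q n = fourier_coeff L g n"
proof -
  note [measurable] = L2loc_measurable[OF Q(1)]
  have [measurable]: "character L n \<in> borel_measurable borel" for n
    by (intro borel_measurable_continuous_onI continuous_character)
  have ae: "AE t in lborel. t \<noteq> 0" "AE t in lborel. t \<noteq> L" by (rule AE_lborel_singleton)+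
  have "fourier_coeff L g n = (LINT t:{0..L}|lborel. character L (- n) t * (Q (t - h) + \<rho> * Q t))"
    unfolding fourier_coeff_def set_lebesgue_integral_def
  proof (rule integral_cong_AE)
    show "AE t in lborel. indicat_real {0..L} t *\<^sub>R (character L (- n) t * g t)
        = indicat_real {0..L} t *\<^sub>R (character L (- n) t * (Q (t - h) + \<rho> * Q t))"
      using ae eq by eventually_elim (auto simp: indicator_def)
  qed measurable
  also have "\<dots> = (LINT t:{0..L}|lborel. character L (- n) t * Q (t - h) + \<rho> * (character L (- n) t * Q t))"
    by (simp add: algebra_simps)
  also have "\<dots> = fourier_coeff L (\<lambda>t. Q (t - h)) n + \<rho> * fourier_coeff L Q n"
    unfolding fourier_coeff_def
    by (subst set_integral_add(2))
      (auto intro!: set_integrable_mult_right L2loc_set_integrable L2loc_cmult L2loc_character_mult L2loc_shift_minus Q)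
  finally show ?thesis by (simp add: fourier_coeff_shift[OF L Q] algebra_simps)
qed

text \<open>In the resonant case the scalar factor either vanishes at some \<open>n > 0\<close> or
  is \<open>O(1 / n)\<close> along infinitely many \<open>n\<close>. Coefficients of
  \<open>g\<close> of size at least \<open>C / n\<close> are incompatible with the former, and with
  the latter because those of \<open>Q\<close> tend to 0.\<close>

lemma circle_nonresonant:
  fixes Q :: "real \<Rightarrow> complex"
  assumes L: "0 < L" and Q: "L2loc Q" "periodic L Q" and [measurable]: "g \<in> borel_measurable borel"
    and eq: "AE t in lborel. 0 < t \<longrightarrow> t < L \<longrightarrow> Q (t - h) + \<rho> * Q t = g t"
    and C: "0 < C" and coeff: "\<And>n. n \<noteq> 0 \<Longrightarrow> C / \<bar>of_int n\<bar> \<le> cmod (fourier_coeff L g n)"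
  shows "nonresonant L h \<rho>"
proof (rule ccontr)
  assume "\<not> nonresonant L h \<rho>"
  then have \<rho>: "cmod \<rho> = 1" and res: "\<And>(b::nat) (a::int). of_nat b * h = of_int a * L \<Longrightarrow> (- \<rho>) ^ b = 1"
    by (auto simp: nonresonant_def)
  note rel = circle_fourier_coeff[OF L Q assms(4) eq]
  \<comment> \<open>Chosen so that \<open>character L (- n) h + \<rho>\<close> is small when
    \<open>n * \<alpha>\<close> is close to \<open>\<eta>\<close> modulo 1, where
    \<open>\<alpha> = h / L\<close>.\<close>
  define \<eta> where "\<eta> = - Arg (- \<rho>) / (2 * pi)"
  have \<rho>\<eta>: "\<rho> = - cis (2 * pi * - \<eta>)"
    using rcis_cmod_Arg[of "- \<rho>"] \<rho> by (simp add: \<eta>_def rcis_def)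
  define \<alpha> where "\<alpha> = h / L"
  have factor: "cmod (character L (- n) h + \<rho>) \<le> 2 * pi * \<bar>of_int n * \<alpha> - \<eta> - of_int m\<bar>" for n m :: int
  proof -
    have "character L (- n) h + \<rho> = cis (2 * pi * of_int m - 2 * pi * of_int n * \<alpha>) - cis (2 * pi * - \<eta>)"
    proof -
      have "character L (- n) h = cis (2 * pi * of_int m) * cis (- (2 * pi * of_int n * \<alpha>))"
        by (simp add: cis_multiple_2pi character_def \<alpha>_def)
      also have "\<dots> = cis (2 * pi * of_int m - 2 * pi * of_int n * \<alpha>)"
        by (simp only: cis_mult diff_conv_add_uminus)
      finally show ?thesis by (simp add: \<rho>\<eta>)
    qed
    also have "cmod \<dots> \<le> \<bar>2 * pi * of_int m - 2 * pi * of_int n * \<alpha> - 2 * pi * - \<eta>\<bar>"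
      by (rule norm_cis_diff_le)
    also have "\<dots> = \<bar>- (2 * pi) * (of_int n * \<alpha> - \<eta> - of_int m)\<bar>"
      by (simp add: algebra_simps)
    also have "\<dots> = 2 * pi * \<bar>of_int n * \<alpha> - \<eta> - of_int m\<bar>"
      unfolding abs_mult by simp
    finally show ?thesis .
  qed
  show False
  proof (cases "\<alpha> \<in> \<rat>")
    case True
    then obtain a b :: int where ab: "0 < b" "coprime a b" "\<alpha> = of_int a / of_int b"
      by (rule Rats_cases') auto
    have "of_nat (nat b) * h = of_int a * L"
      using ab L by (simp add: \<alpha>_def field_simps)
    \<comment> \<open>Resonance makes \<open>b * \<eta>\<close> an integer, so the vanishing of the
      factor becomes a linear Diophantine equation.\<close>
    then have "(- \<rho>) ^ nat b = 1" by (rule res)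
    then have "cis (of_int b * (2 * pi * - \<eta>)) = 1"
      using ab(1) by (simp add: \<rho>\<eta> Complex.DeMoivre)
    then obtain k :: int where "of_int b * (2 * pi * - \<eta>) = 2 * pi * of_int k"
      by (auto simp: cis_conv_exp exp_eq_1 algebra_simps)
    then have "(2 * pi) * (of_int b * \<eta>) = (2 * pi) * - of_int k" by (simp add: algebra_simps)
    then have k: "of_int b * \<eta> = - of_int k" by (subst (asm) mult_cancel_left) simp
    obtain u v where uv: "u * a + v * b = 1"
      using ab(2) by (metis bezout_int coprime_imp_gcd_eq_1)
    \<comment> \<open>Bezout solution of \<open>n * a - m * b = - k\<close>, moved by a multiple of
      \<open>(b, a)\<close> to make \<open>n\<close> positive.\<close>
    define n where "n = - k * u + b * (\<bar>k * u\<bar> + 1)"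
    define m where "m = k * v + a * (\<bar>k * u\<bar> + 1)"
    have "n > 0"
    proof -
      have "k * u < 1 * (\<bar>k * u\<bar> + 1)" by simp
      also have "\<dots> \<le> b * (\<bar>k * u\<bar> + 1)" using ab by (intro mult_right_mono) auto
      finally show ?thesis by (simp add: n_def)
    qed
    have "n * a - m * b + k = k * (1 - (u * a + v * b))"
      by (simp add: n_def m_def algebra_simps)
    then have "of_int (n * a - m * b + k) = (0 :: real)" using uv by simp
    then have "of_int b * (of_int n * \<alpha> - \<eta> - of_int m) = (0 :: real)"
      using k ab by (simp add: right_diff_distrib mult.commute)
    then have "of_int n * \<alpha> - \<eta> - of_int m = 0" using ab by simp
    then have "fourier_coeff L g n = 0"
      using factor[of n m] rel[of n] by simp
    moreover have "0 < C / \<bar>of_int n\<bar>" using C \<open>n > 0\<close> by simp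
    ultimately show False using coeff[of n] \<open>n > 0\<close> by simp
  next
    case False
    \<comment> \<open>From
      \<open>C / n \<le> 2 * pi * (5 / n) * cmod (fourier_coeff L Q n)\<close>.\<close>
    define c where "c = C / (10 * pi)"
    have c: "0 < c" using C by (simp add: c_def)
    have "finite {n. c \<le> cmod (fourier_coeff L Q n)}"
      by (rule finite_large_fourier_coeffs[OF L Q(1) c])
    then obtain K where K: "\<And>n. c \<le> cmod (fourier_coeff L Q n) \<Longrightarrow> n \<le> K"
      by (metis (mono_tags) Max_ge mem_Collect_eq)
    obtain n m :: int where nm: "K < n" "0 < n" "\<bar>of_int n * \<alpha> - \<eta> - of_int m\<bar> \<le> 5 / of_int n"
      using inhomogeneous_approximation[OF False] by blast
    have "C / of_int n \<le> cmod (character L (- n) h + \<rho>) * cmod (fourier_coeff L Q n)"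
      using coeff[of n] nm(2) by (simp flip: rel norm_mult)
    also have "\<dots> \<le> (2 * pi * (5 / of_int n)) * cmod (fourier_coeff L Q n)"
      by (intro mult_right_mono order_trans[OF factor[of n m]] mult_left_mono nm) auto
    finally have "c \<le> cmod (fourier_coeff L Q n)"
      using nm(2) by (simp add: c_def field_simps)
    then show False using K nm(1) by fastforce
  qed
qed

section \<open>Flat outputs\<close>

lemma L2loc_periodize:
  fixes f :: "real \<Rightarrow> 'a::euclidean_space"
  assumes L: "0 < L" and f: "L2loc f"
  obtains g where "L2loc g" "periodic L g" "\<And>t. c \<le> t \<Longrightarrow> t < c + L \<Longrightarrow> g t = f t"
proof -
  define h where "h = (\<lambda>t. f (t - of_int \<lfloor>t / L\<rfloor> * L + c))"
  note [measurable] = L2loc_measurable[OF f]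
  have hm [measurable]: "h \<in> borel_measurable borel" unfolding h_def by measurable
  have hp: "periodic L h"
    using L by (simp add: periodic_def h_def add_divide_distrib algebra_simps)
  have hf: "h t = f (t + c)" if "0 \<le> t" "t < L" for t
  proof -
    have "\<lfloor>t / L\<rfloor> = 0" using that by (simp add: floor_eq_iff)
    then show ?thesis by (simp add: h_def)
  qed
  have "set_integrable lborel {0..L} (\<lambda>t. (norm (f (t + c)))\<^sup>2)"
    by (intro L2loc_integrable L2loc_shift f)
  moreover have "AE t in lborel. t \<in> {0..L} \<longrightarrow> (norm (f (t + c)))\<^sup>2 = (norm (h t))\<^sup>2"
    using AE_lborel_singleton[of L] by eventually_elim (auto simp: hf)
  ultimately have "set_integrable lborel {0..L} (\<lambda>t. (norm (h t))\<^sup>2)"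
    by (subst (asm) set_integrable_cong_AE[where g="\<lambda>t. (norm (h t))\<^sup>2"]) simp_all
  then have "L2loc h" by (intro L2loc_periodic[OF L hp]) auto
  then have "L2loc (\<lambda>t. h (t + - c))" by (rule L2loc_shift)
  moreover have "periodic L (\<lambda>t. h (t + - c))" by (rule periodic_shift[OF hp])
  moreover have "h (t + - c) = f t" if "c \<le> t" "t < c + L" for t
    using hf[of "t + - c"] that by simp
  ultimately show ?thesis using that by blast
qed

text \<open>The first period after \<open>- a - L\<close> is repeated to give \<open>Q1\<close>; the
  relation then carries the agreement forward to 0, period by period.\<close>

lemma AE_periodic_extension:
  fixes Q :: "real \<Rightarrow> 'a::euclidean_space"
  assumes L: "0 < L" and Q: "L2loc Q"
    and per: "AE t in lborel. - a < t \<longrightarrow> t < 0 \<longrightarrow> Q t = Q (t - L)"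
  obtains Q1 where "L2loc Q1" "periodic L Q1"
    "AE t in lborel. - a - L < t \<longrightarrow> t < 0 \<longrightarrow> Q t = Q1 t"
proof -
  obtain Q1 where Q1: "L2loc Q1" "periodic L Q1"
    "\<And>t. - a - L \<le> t \<Longrightarrow> t < - a - L + L \<Longrightarrow> Q1 t = Q t"
    using L2loc_periodize[OF L Q, where c = "- a - L"] by blast
  have pm: "Q1 (t - L) = Q1 t" for t
    using Q1(2) unfolding periodic_def by (metis diff_add_cancel)
  have "AE t in lborel. t < 0 \<longrightarrow> (- a - L < t \<longrightarrow> Q t = Q1 t)"
  proof (rule AE_delay_induct[OF L L, where s = "- a"])
    show "AE t in lborel. t < - a \<longrightarrow> - a - L < t \<longrightarrow> Q t = Q1 t"
      using Q1(3) by (intro AE_I2) auto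
    show "AE t in lborel. - a < t \<longrightarrow> t < 0 \<longrightarrow> (- a - L < t - L \<longrightarrow> Q (t - L) = Q1 (t - L)) \<longrightarrow>
        (- a - L < t - L \<longrightarrow> Q (t - L) = Q1 (t - L)) \<longrightarrow> - a - L < t \<longrightarrow> Q t = Q1 t"
      using per by eventually_elim (auto simp: pm)
  qed
  then have "AE t in lborel. - a - L < t \<longrightarrow> t < 0 \<longrightarrow> Q t = Q1 t"
    by eventually_elim auto
  then show ?thesis using Q1 that by blast
qed

text \<open>Time is shifted so that the final time is 0 and the control acts on \<open>(-T, 0)\<close>. Here \<open>P\<close> is the flat
  output, \<open>yp\<close> is the target of the free coordinate and \<open>yz\<close> that of the uncontrolled one.\<close>

definition reaches ::
  "real \<Rightarrow> real \<Rightarrow> complex \<Rightarrow> complex \<Rightarrow> complex \<Rightarrow> complex \<Rightarrow> real \<Rightarrow>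
   (real \<Rightarrow> complex) \<Rightarrow> (real \<Rightarrow> complex) \<Rightarrow> (real \<Rightarrow> complex) \<Rightarrow> bool" where
  "reaches \<Lambda>1 \<Lambda>2 g1 g2 c1 c2 T yp yz P \<longleftrightarrow> L2loc P \<and> (\<forall>t\<le>- T. P t = 0) \<and>
     (AE t in lborel. - \<Lambda>1 < t \<longrightarrow> t < 0 \<longrightarrow>
        P t - g1 * P (t - \<Lambda>1) - g2 * P (t - \<Lambda>2) = yp t \<and>
        c1 * P (t - \<Lambda>1) + c2 * P (t - \<Lambda>2) = yz t)"

text \<open>For \<open>T < 2 * \<Lambda>1\<close>, \<open>P\<close> would have to be both 1 and 0 on
  \<open>(- 2 * \<Lambda>1, - T)\<close>.\<close>

lemma horizon_ge:
  assumes P: "reaches \<Lambda>1 \<Lambda>2 g1 g2 c1 c2 T yp yz P" "0 < \<Lambda>1" "0 < T"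
    and one: "AE t in lborel. - 2 * \<Lambda>1 < t \<longrightarrow> t < 0 \<longrightarrow> P t = 1"
  shows "2 * \<Lambda>1 \<le> T"
proof (rule ccontr)
  assume "\<not> 2 * \<Lambda>1 \<le> T"
  then have "- 2 * \<Lambda>1 < - T" by simp
  moreover have "AE t in lborel. - 2 * \<Lambda>1 < t \<longrightarrow> t < - T \<longrightarrow> P t = 1"
    using one by eventually_elim (use \<open>0 < T\<close> in auto)
  ultimately obtain t where "t < - T" "P t = 1" by (rule AE_interval_witness)
  then show False using P by (auto simp: reaches_def)
qed

section \<open>From constant targets to all targets, for flat outputs\<close>

context
  fixes \<Lambda>1 \<Lambda>2 :: real
  assumes \<Lambda>: "0 < \<Lambda>2" "\<Lambda>2 < \<Lambda>1"
begin

text \<open>On \<open>(- \<Lambda>1, - \<Lambda>2)\<close> the second equation, read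
  \<open>\<Lambda>2\<close> later, fixes \<open>P t\<close> in the first, so
  \<open>yz (t + \<Lambda>2) - a * P (t - \<Lambda>1) = yp t\<close>. The constant target
  \<open>(1, 0)\<close> therefore forces \<open>a \<noteq> 0\<close> and
  \<open>T \<ge> 2 * \<Lambda>1\<close>, and then \<open>P\<close> can be written down.\<close>

lemma reaches_all_long_delay:
  assumes T: "0 < T"
    and const: "\<And>cp cz. \<exists>P. reaches \<Lambda>1 \<Lambda>2 a 0 0 1 T (\<lambda>_. cp) (\<lambda>_. cz) P"
    and y: "L2loc yp" "L2loc yz"
  shows "\<exists>P. reaches \<Lambda>1 \<Lambda>2 a 0 0 1 T yp yz P"
proof -
  have first: "AE t in lborel. - \<Lambda>1 < t \<longrightarrow> t < - \<Lambda>2 \<longrightarrow> cz - a * P (t - \<Lambda>1) = cp"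
    if P: "reaches \<Lambda>1 \<Lambda>2 a 0 0 1 T (\<lambda>_. cp) (\<lambda>_. cz) P" for P cp cz
  proof -
    have ae: "AE t in lborel. - \<Lambda>1 < t \<longrightarrow> t < 0 \<longrightarrow> P t - a * P (t - \<Lambda>1) = cp \<and> P (t - \<Lambda>2) = cz"
      using P by (simp add: reaches_def)
    from ae AE_lborel_shift[OF ae, of \<Lambda>2] show ?thesis
      by eventually_elim (use \<Lambda> in auto)
  qed
  have a0: "a \<noteq> 0"
  proof
    assume "a = 0"
    obtain P where "reaches \<Lambda>1 \<Lambda>2 a 0 0 1 T (\<lambda>_. 1) (\<lambda>_. 0) P" using const by blast
    from AE_interval_witness[OF _ first[OF this]] \<Lambda> \<open>a = 0\<close> show False by auto
  qed
  obtain P where P: "reaches \<Lambda>1 \<Lambda>2 a 0 0 1 T (\<lambda>_. 1) (\<lambda>_. 0) P" using const by blast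
  \<comment> \<open>The target \<open>(1, 0)\<close> requires \<open>P = - 1 / a\<close> just after
    \<open>- 2 * \<Lambda>1\<close>, whereas \<open>P\<close> vanishes up to
    \<open>- T\<close>.\<close>
  have T2: "2 * \<Lambda>1 \<le> T"
  proof (rule ccontr)
    assume "\<not> 2 * \<Lambda>1 \<le> T"
    then have "- \<Lambda>1 < min (- \<Lambda>2) (\<Lambda>1 - T)" using \<Lambda> by simp
    moreover have "AE t in lborel. - \<Lambda>1 < t \<longrightarrow> t < min (- \<Lambda>2) (\<Lambda>1 - T) \<longrightarrow> 0 - a * P (t - \<Lambda>1) = 1"
      using first[OF P] by eventually_elim auto
    ultimately obtain t where "t < min (- \<Lambda>2) (\<Lambda>1 - T)" "0 - a * P (t - \<Lambda>1) = 1"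
      by (rule AE_interval_witness)
    moreover from this have "P (t - \<Lambda>1) = 0" using P by (auto simp: reaches_def)
    ultimately show False by simp
  qed
  \<comment> \<open>The middle piece solves the second equation. The earlier piece solves the first
    equation on \<open>(- \<Lambda>1, - \<Lambda>2)\<close> for \<open>P (t - \<Lambda>1)\<close>,
    and the last piece solves it on \<open>(- \<Lambda>2, 0)\<close> for \<open>P t\<close>.\<close>
  define P where "P = (\<lambda>t. if t \<le> - 2 * \<Lambda>1 then 0
     else if t \<le> - \<Lambda>1 - \<Lambda>2 then inverse a * (yz (t + (\<Lambda>1 + \<Lambda>2)) - yp (t + \<Lambda>1))
     else if t < - \<Lambda>2 then yz (t + \<Lambda>2) else yp t + a * yz (t + (\<Lambda>2 - \<Lambda>1)))"
  have "L2loc P" unfolding P_def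
    by (intro L2loc_if L2loc_const L2loc_add L2loc_diff L2loc_cmult L2loc_shift y) simp_all
  moreover have "\<forall>t\<le>- T. P t = 0" using T2 by (auto simp: P_def)
  moreover
  \<comment> \<open>At \<open>t = - \<Lambda>2\<close> the delayed point
    \<open>t - \<Lambda>1\<close> is the breakpoint between two pieces of \<open>P\<close>, so this
    \<open>t\<close> is left out.\<close>
  have pt: "P t - a * P (t - \<Lambda>1) = yp t \<and> P (t - \<Lambda>2) = yz t"
    if "- \<Lambda>1 < t" "t < 0" "t \<noteq> - \<Lambda>2" for t
  proof (cases "t < - \<Lambda>2")
    case True
    have "t - \<Lambda>1 + (\<Lambda>1 + \<Lambda>2) = t + \<Lambda>2" "t - \<Lambda>1 + \<Lambda>1 = t" by simp_all
    then have "P (t - \<Lambda>1) = inverse a * (yz (t + \<Lambda>2) - yp t)"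
      using that True \<Lambda> by (simp add: P_def del: add_diff_cancel)
    then have "a * P (t - \<Lambda>1) = yz (t + \<Lambda>2) - yp t" using a0 by simp
    moreover have "P t = yz (t + \<Lambda>2)" "P (t - \<Lambda>2) = yz t" using that True \<Lambda> by (simp_all add: P_def)
    ultimately show ?thesis by simp
  next
    case False
    then show ?thesis using that \<Lambda> by (auto simp: P_def algebra_simps)
  qed
  have "AE t in lborel. - \<Lambda>1 < t \<longrightarrow> t < 0 \<longrightarrow> P t - a * P (t - \<Lambda>1) = yp t \<and> P (t - \<Lambda>2) = yz t"
    using AE_lborel_singleton[of "- \<Lambda>2"] by eventually_elim (use pt in blast)
  ultimately show ?thesis by (intro exI[of _ P]) (simp add: reaches_def)
qed

text \<open>With \<open>\<gamma> = 0\<close> the second target equation is a recursion with step \<open>\<Lambda>1 - \<Lambda>2\<close> backwards in time.\<close>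

lemma reaches_all_nilpotent:
  assumes T: "0 < T"
    and const: "\<And>cp cz. \<exists>P. reaches \<Lambda>1 \<Lambda>2 0 0 1 \<beta> T (\<lambda>_. cp) (\<lambda>_. cz) P"
    and y: "L2loc yp" "L2loc yz"
  shows "\<exists>P. reaches \<Lambda>1 \<Lambda>2 0 0 1 \<beta> T yp yz P"
proof -
  define \<delta> where "\<delta> = \<Lambda>1 - \<Lambda>2"
  have \<delta>: "0 < \<delta>" using \<Lambda> by (simp add: \<delta>_def)
  \<comment> \<open>These are the targets of the constant flat output 1.\<close>
  obtain P where P: "reaches \<Lambda>1 \<Lambda>2 0 0 1 \<beta> T (\<lambda>_. 1) (\<lambda>_. 1 + \<beta>) P" using const by blast
  then have ae: "AE t in lborel. - \<Lambda>1 < t \<longrightarrow> t < 0 \<longrightarrow> P t = 1 \<and> P (t - \<Lambda>1) + \<beta> * P (t - \<Lambda>2) = 1 + \<beta>"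
    by (simp add: reaches_def)
  \<comment> \<open>With time reversed, for \<open>\<tau> > \<Lambda>1\<close> the second equation
    at \<open>\<Lambda>1 - \<tau>\<close> gives \<open>P (- \<tau>)\<close> from
    \<open>P (- (\<tau> - \<delta>))\<close>, so the value 1 persists back to
    \<open>- 2 * \<Lambda>1\<close>.\<close>
  have "AE \<tau> in lborel. \<tau> < 2 * \<Lambda>1 \<longrightarrow> (0 < \<tau> \<longrightarrow> P (- \<tau>) = 1)"
  proof (rule AE_delay_induct[OF \<delta> \<delta>, where s = \<Lambda>1])
    show "AE \<tau> in lborel. \<tau> < \<Lambda>1 \<longrightarrow> 0 < \<tau> \<longrightarrow> P (- \<tau>) = 1"
      using AE_lborel_reflect[OF ae] by eventually_elim auto
    show "AE \<tau> in lborel. \<Lambda>1 < \<tau> \<longrightarrow> \<tau> < 2 * \<Lambda>1 \<longrightarrow> (0 < \<tau> - \<delta> \<longrightarrow> P (- (\<tau> - \<delta>)) = 1) \<longrightarrow>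
        (0 < \<tau> - \<delta> \<longrightarrow> P (- (\<tau> - \<delta>)) = 1) \<longrightarrow> 0 < \<tau> \<longrightarrow> P (- \<tau>) = 1"
      using AE_lborel_reflect[OF AE_lborel_shift[OF ae, of \<Lambda>1]]
    proof eventually_elim
      case (elim \<tau>)
      then show ?case using \<Lambda> by (auto simp: \<delta>_def algebra_simps)
    qed
  qed
  from AE_lborel_reflect[OF this] have "AE t in lborel. - 2 * \<Lambda>1 < t \<longrightarrow> t < 0 \<longrightarrow> P t = 1"
    by eventually_elim auto
  then have T2: "2 * \<Lambda>1 \<le> T"
    using horizon_ge[OF P] \<Lambda> T by simp
  have lin: "bounded_linear (\<lambda>_::complex. 0 :: complex)" "bounded_linear (\<lambda>x. - \<beta> * x)"
    by (rule bounded_linear_zero, rule bounded_linear_mult_right)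
  \<comment> \<open>\<open>R \<tau>\<close> stands for \<open>P (- \<tau>)\<close>:
    \<open>yp\<close> prescribes it up to \<open>\<Lambda>1\<close>, the second equation from there
    to \<open>2 * \<Lambda>1\<close>.\<close>
  obtain R where R: "L2loc R" "\<And>\<tau>. \<tau> \<le> \<Lambda>1 \<Longrightarrow> R \<tau> = yp (- \<tau>)"
    "\<And>\<tau>. \<Lambda>1 < \<tau> \<Longrightarrow> \<tau> \<le> 2 * \<Lambda>1 \<Longrightarrow> R \<tau> = 0 + - \<beta> * R (\<tau> - \<delta>) + yz (- \<tau> + \<Lambda>1)"
    using delay_recursion[OF \<delta> \<delta> lin L2loc_reflect[OF y(1)] L2loc_reflect[OF L2loc_shift[OF y(2), of \<Lambda>1]]]
    by metis
  define P where "P = (\<lambda>t. if - 2 * \<Lambda>1 < t then R (- t) else 0)"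
  have "L2loc P" unfolding P_def
    by (intro L2loc_if L2loc_const L2loc_reflect R) simp
  moreover have "\<forall>t\<le>- T. P t = 0" using T2 by (auto simp: P_def)
  moreover have "P t = yp t \<and> P (t - \<Lambda>1) + \<beta> * P (t - \<Lambda>2) = yz t" if "- \<Lambda>1 < t" "t < 0" for t
  proof -
    have "P t = yp t" using that R(2)[of "- t"] \<Lambda> by (simp add: P_def)
    moreover have "P (t - \<Lambda>2) = R (\<Lambda>2 - t)" using that \<Lambda> by (simp add: P_def)
    moreover have "P (t - \<Lambda>1) = - \<beta> * R (\<Lambda>2 - t) + yz t"
      using that R(3)[of "\<Lambda>1 - t"] \<Lambda> by (simp add: P_def \<delta>_def algebra_simps)
    ultimately show ?thesis by simp
  qed
  ultimately show ?thesis by (intro exI[of _ P]) (simp add: reaches_def)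
qed

text \<open>\<open>Q0\<close> solves the first equation, and adding a
  \<open>\<Lambda>2\<close>-periodic \<open>Q1\<close> preserves this. The second equation on the
  last period determines \<open>Q1\<close>; at earlier times it defines \<open>Q\<close> where the
  first equation leaves it free.\<close>

lemma solve_on_circle:
  assumes nr: "nonresonant \<Lambda>2 \<Lambda>1 \<rho>" and ab: "L2loc a" "L2loc b"
  obtains Q where "L2loc Q" "\<And>t. t \<le> - 2 * \<Lambda>1 \<Longrightarrow> Q t = 0"
    "AE t in lborel. - \<Lambda>1 < t \<longrightarrow> t < 0 \<longrightarrow>
       Q t - Q (t - \<Lambda>2) = a t \<and> Q (t - \<Lambda>1) + \<rho> * Q (t - \<Lambda>2) = b t"
proof -
  have lin: "bounded_linear (\<lambda>_::complex. 0 :: complex)" "bounded_linear (\<lambda>x::complex. x)"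
    by (rule bounded_linear_zero, rule bounded_linear_ident)
  obtain Q0 where Q0: "L2loc Q0" "\<And>t. t \<le> - \<Lambda>1 \<Longrightarrow> Q0 t = 0"
    "\<And>t. - \<Lambda>1 < t \<Longrightarrow> t \<le> 0 \<Longrightarrow> Q0 t = 0 + Q0 (t - \<Lambda>2) + a t"
    using delay_recursion[OF \<Lambda>(1) \<Lambda>(1) lin L2loc_const[of 0] ab(1)] by metis
  \<comment> \<open>For \<open>t\<close> in \<open>(- \<Lambda>2, 0)\<close> both delayed points lie
    above \<open>- \<Lambda>1 - \<Lambda>2\<close>, where \<open>Q = Q0 + Q1\<close>; since
    \<open>Q1 (t - \<Lambda>2) = Q1 t\<close>, this leaves an equation for \<open>Q1\<close> on the
    circle.\<close>
  have "L2loc (\<lambda>t. b t - (Q0 (t - \<Lambda>1) + \<rho> * Q0 (t - \<Lambda>2)))"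
    by (intro L2loc_diff L2loc_add L2loc_cmult L2loc_shift_minus ab Q0)
  from L2loc_periodize[OF \<Lambda>(1) this, where c = "- \<Lambda>2"]
  obtain g where g: "L2loc g" "periodic \<Lambda>2 g"
    "\<And>t. - \<Lambda>2 \<le> t \<Longrightarrow> t < 0 \<Longrightarrow> g t = b t - (Q0 (t - \<Lambda>1) + \<rho> * Q0 (t - \<Lambda>2))"
    by (metis add.left_inverse)
  obtain Q1 where Q1: "L2loc Q1" "periodic \<Lambda>2 Q1" "AE t in lborel. Q1 (t - \<Lambda>1) + \<rho> * Q1 t = g t"
    using circle_solve[OF \<Lambda>(1) nr g(1,2)] by blast
  have pm: "Q1 (t - \<Lambda>2) = Q1 t" for t
    using Q1(2) unfolding periodic_def by (metis diff_add_cancel)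
  define S where "S = (\<lambda>t. Q0 t + Q1 t)"
  \<comment> \<open>The first equation involves \<open>Q\<close> only after
    \<open>- \<Lambda>1 - \<Lambda>2\<close>, so up to that time the second one can serve as a
    definition.\<close>
  define Q where "Q = (\<lambda>t. if t \<le> - 2 * \<Lambda>1 then 0
    else if t \<le> - \<Lambda>1 - \<Lambda>2 then b (t + \<Lambda>1) - \<rho> * S (t + (\<Lambda>1 - \<Lambda>2)) else S t)"
  have "L2loc Q" unfolding Q_def S_def
    by (intro L2loc_if L2loc_const L2loc_diff L2loc_cmult L2loc_shift L2loc_add ab Q0 Q1) simp_all
  moreover have "Q t = 0" if "t \<le> - 2 * \<Lambda>1" for t using that by (simp add: Q_def)
  moreover have "AE t in lborel. - \<Lambda>1 < t \<longrightarrow> t < 0 \<longrightarrow>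
       Q t - Q (t - \<Lambda>2) = a t \<and> Q (t - \<Lambda>1) + \<rho> * Q (t - \<Lambda>2) = b t"
    using Q1(3)
  proof eventually_elim
    case (elim t)
    show ?case
    proof (intro impI)
      assume t: "- \<Lambda>1 < t" "t < 0"
      have e: "Q t = S t" "Q (t - \<Lambda>2) = S (t - \<Lambda>2)" using t \<Lambda> by (simp_all add: Q_def)
      have "S t - S (t - \<Lambda>2) = a t" using Q0(3)[of t] t by (simp add: S_def pm)
      moreover have "Q (t - \<Lambda>1) + \<rho> * S (t - \<Lambda>2) = b t"
      proof (cases "t \<le> - \<Lambda>2")
        case True
        then show ?thesis using t by (simp add: Q_def)
      next
        case False
        then have "Q (t - \<Lambda>1) = S (t - \<Lambda>1)" using t by (simp add: Q_def)
        then show ?thesis using elim g(3)[of t] False t by (simp add: S_def pm algebra_simps)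
      qed
      ultimately show "Q t - Q (t - \<Lambda>2) = a t \<and> Q (t - \<Lambda>1) + \<rho> * Q (t - \<Lambda>2) = b t"
        by (simp add: e)
    qed
  qed
  ultimately show ?thesis using that by blast
qed

text \<open>The converse direction: a vanishing first target makes \<open>Q\<close> periodic on
  \<open>(- \<Lambda>1 - \<Lambda>2, 0)\<close>, and the second equation on the last period, moved
  to \<open>(0, \<Lambda>2)\<close>, becomes an equation on the circle.\<close>

lemma circle_equation:
  fixes Q :: "real \<Rightarrow> complex"
  assumes Q: "L2loc Q"
    and eq: "AE t in lborel. - \<Lambda>1 < t \<longrightarrow> t < 0 \<longrightarrow>
       Q t - Q (t - \<Lambda>2) = 0 \<and> Q (t - \<Lambda>1) + \<rho> * Q (t - \<Lambda>2) = b t"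
  obtains Q1 where "L2loc Q1" "periodic \<Lambda>2 Q1"
    "AE t in lborel. - \<Lambda>1 - \<Lambda>2 < t \<longrightarrow> t < 0 \<longrightarrow> Q t = Q1 t"
    "AE t in lborel. 0 < t \<longrightarrow> t < \<Lambda>2 \<longrightarrow> Q1 (t - \<Lambda>1) + \<rho> * Q1 t = b (t - \<Lambda>2)"
proof -
  have "AE t in lborel. - \<Lambda>1 < t \<longrightarrow> t < 0 \<longrightarrow> Q t = Q (t - \<Lambda>2)"
    using eq by eventually_elim auto
  then obtain Q1 where Q1: "L2loc Q1" "periodic \<Lambda>2 Q1"
    "AE t in lborel. - \<Lambda>1 - \<Lambda>2 < t \<longrightarrow> t < 0 \<longrightarrow> Q t = Q1 t"
    using AE_periodic_extension[OF \<Lambda>(1) Q] by blast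
  have pm: "Q1 (t - \<Lambda>2) = Q1 t" for t
    using Q1(2) unfolding periodic_def by (metis diff_add_cancel)
  have pm2: "Q1 (t - \<Lambda>2 - \<Lambda>1) = Q1 (t - \<Lambda>1)" for t
    using pm[of "t - \<Lambda>1"] by (simp add: algebra_simps)
  from AE_lborel_shift[OF eq, of "- \<Lambda>2"] AE_lborel_shift[OF Q1(3), of "- \<Lambda>2 - \<Lambda>1"]
    AE_lborel_shift[OF Q1(3), of "- 2 * \<Lambda>2"]
  have "AE t in lborel. 0 < t \<longrightarrow> t < \<Lambda>2 \<longrightarrow> Q1 (t - \<Lambda>1) + \<rho> * Q1 t = b (t - \<Lambda>2)"
  proof eventually_elim
    case (elim t)
    show ?case
    proof (intro impI)
      assume t: "0 < t" "t < \<Lambda>2"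
      have "t + - 2 * \<Lambda>2 = t - \<Lambda>2 - \<Lambda>2" "t + (- \<Lambda>2 - \<Lambda>1) = t - \<Lambda>2 - \<Lambda>1" by simp_all
      moreover have "Q (t + (- \<Lambda>2 - \<Lambda>1)) = Q1 (t + (- \<Lambda>2 - \<Lambda>1))" "Q (t + - 2 * \<Lambda>2) = Q1 (t + - 2 * \<Lambda>2)"
        using elim(2,3) t \<Lambda> by simp_all
      ultimately have "Q (t - \<Lambda>2 - \<Lambda>1) = Q1 (t - \<Lambda>1)" "Q (t - \<Lambda>2 - \<Lambda>2) = Q1 t"
        by (simp_all only: pm pm2)
      moreover have "Q (t - \<Lambda>2 - \<Lambda>1) + \<rho> * Q (t - \<Lambda>2 - \<Lambda>2) = b (t - \<Lambda>2)"
        using elim(1) t \<Lambda> by simp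
      ultimately show "Q1 (t - \<Lambda>1) + \<rho> * Q1 t = b (t - \<Lambda>2)" by simp
    qed
  qed
  with Q1 that show ?thesis by blast
qed

text \<open>The Fourier coefficients are \<open>K * (exp (\<mu> * \<Lambda>2) - 1) / a\<close> with
  \<open>a = \<mu> - 2 * pi * \<i> * n / \<Lambda>2\<close>. The numerator is nonzero because of the
  jump at the end of the period, and \<open>cmod a \<le> (cmod \<mu> + 2 * pi / \<Lambda>2) *
  \<bar>n\<bar>\<close> gives \<open>C\<close>.\<close>

lemma nonresonant_exponential:
  assumes Q: "L2loc Q" "periodic \<Lambda>2 Q" and K: "K \<noteq> 0" and \<mu>: "exp (\<mu> * of_real \<Lambda>2) \<noteq> (1 :: complex)"
    and eq: "AE t in lborel. 0 < t \<longrightarrow> t < \<Lambda>2 \<longrightarrow> Q (t - \<Lambda>1) + \<rho> * Q t = K * exp (\<mu> * of_real t)"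
  shows "nonresonant \<Lambda>2 \<Lambda>1 \<rho>"
proof (rule circle_nonresonant[OF \<Lambda>(1) Q _ eq])
  define C where "C = cmod (K * (exp (\<mu> * of_real \<Lambda>2) - 1)) / (cmod \<mu> + 2 * pi / \<Lambda>2)"
  have den: "0 < cmod \<mu> + 2 * pi / \<Lambda>2" using \<Lambda> by (intro add_nonneg_pos) auto
  then show "0 < C" using K \<mu> by (simp add: C_def)
  show "(\<lambda>t. K * exp (\<mu> * of_real t)) \<in> borel_measurable borel"
    by (intro borel_measurable_continuous_onI continuous_intros)
  fix n :: int assume n: "n \<noteq> 0"
  define a where "a = \<mu> - 2 * pi * \<i> * of_int n / of_real \<Lambda>2"
  have "exp (a * of_real \<Lambda>2) = exp (\<mu> * of_real \<Lambda>2) * character \<Lambda>2 (- n) \<Lambda>2"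
    unfolding character_conv_exp exp_add[symmetric] using \<Lambda> by (simp add: a_def algebra_simps)
  then have ea: "exp (a * of_real \<Lambda>2) = exp (\<mu> * of_real \<Lambda>2)"
    using \<Lambda> by (simp add: character_period)
  then have a: "a \<noteq> 0" using \<mu> by auto
  have "character \<Lambda>2 (- n) t * (K * exp (\<mu> * of_real t)) = K * exp (a * of_real t)" for t
    unfolding character_conv_exp by (simp add: a_def algebra_simps exp_add[symmetric])
  then have "fourier_coeff \<Lambda>2 (\<lambda>t. K * exp (\<mu> * of_real t)) n
      = K * ((exp (\<mu> * of_real \<Lambda>2) - 1) / a)"
    by (simp only: fourier_coeff_def set_integral_mult_right
        integral_exp_period[OF less_imp_le[OF \<Lambda>(1)] a] ea)
  then have eq: "cmod (fourier_coeff \<Lambda>2 (\<lambda>t. K * exp (\<mu> * of_real t)) n)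
      = cmod (K * (exp (\<mu> * of_real \<Lambda>2) - 1)) / cmod a"
    by (simp add: norm_mult norm_divide)
  have "cmod a \<le> cmod \<mu> + cmod (2 * pi * \<i> * of_int n / complex_of_real \<Lambda>2)"
    unfolding a_def by (rule norm_triangle_ineq4)
  also have "cmod (2 * pi * \<i> * of_int n / complex_of_real \<Lambda>2) = 2 * pi / \<Lambda>2 * \<bar>of_int n\<bar>"
    using \<Lambda> by (simp add: norm_mult norm_divide)
  also have "cmod \<mu> + 2 * pi / \<Lambda>2 * \<bar>of_int n\<bar> \<le> cmod \<mu> * \<bar>of_int n\<bar> + 2 * pi / \<Lambda>2 * \<bar>of_int n\<bar>"
    using n mult_left_mono[of 1 "\<bar>real_of_int n\<bar>" "cmod \<mu>"] by simp
  finally have "cmod a \<le> (cmod \<mu> + 2 * pi / \<Lambda>2) * \<bar>of_int n\<bar>" by (simp add: distrib_right)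
  then have "cmod (K * (exp (\<mu> * of_real \<Lambda>2) - 1)) / ((cmod \<mu> + 2 * pi / \<Lambda>2) * \<bar>of_int n\<bar>)
      \<le> cmod (K * (exp (\<mu> * of_real \<Lambda>2) - 1)) / cmod a"
    using a by (intro divide_left_mono) (auto intro!: mult_pos_pos den simp: n)
  then show "C / \<bar>of_int n\<bar> \<le> cmod (fourier_coeff \<Lambda>2 (\<lambda>t. K * exp (\<mu> * of_real t)) n)"
    unfolding eq C_def by simp
qed

text \<open>At nonzero frequencies the constant contributes nothing and the linear term contributes
  a coefficient of modulus exactly \<open>C / \<bar>n\<bar>\<close>.\<close>

lemma nonresonant_affine:
  assumes Q: "L2loc Q" "periodic \<Lambda>2 Q" and K: "K \<noteq> 0"
    and eq: "AE t in lborel. 0 < t \<longrightarrow> t < \<Lambda>2 \<longrightarrow> Q (t - \<Lambda>1) + \<rho> * Q t = K * of_real t + K'"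
  shows "nonresonant \<Lambda>2 \<Lambda>1 \<rho>"
proof (rule circle_nonresonant[OF \<Lambda>(1) Q _ eq])
  define C where "C = cmod K * \<Lambda>2\<^sup>2 / (2 * pi)"
  show "0 < C" using K \<Lambda> by (simp add: C_def)
  show "(\<lambda>t. K * of_real t + K') \<in> borel_measurable borel"
    by (intro borel_measurable_continuous_onI continuous_intros)
  fix n :: int assume n: "n \<noteq> 0"
  define a where "a = - 2 * pi * \<i> * of_int n / complex_of_real \<Lambda>2"
  have ch: "character \<Lambda>2 (- n) t = exp (a * of_real t)" for t
    unfolding character_conv_exp by (simp add: a_def)
  then have ea: "exp (a * of_real \<Lambda>2) = 1"
    using \<Lambda> character_period[of \<Lambda>2 "- n"] by simp
  have a: "a \<noteq> 0" using n \<Lambda> by (simp add: a_def)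
  have si: "set_integrable lborel {0..\<Lambda>2} (\<lambda>t. K * (of_real t * exp (a * of_real t)))"
    "set_integrable lborel {0..\<Lambda>2} (\<lambda>t. K' * exp (a * of_real t))"
    by (intro borel_integrable_atLeastAtMost' continuous_intros)+
  have "fourier_coeff \<Lambda>2 (\<lambda>t. K * of_real t + K') n
     = (LINT t:{0..\<Lambda>2}|lborel. K * (of_real t * exp (a * of_real t)) + K' * exp (a * of_real t))"
    by (simp add: fourier_coeff_def ch algebra_simps)
  also have "\<dots> = K * (of_real \<Lambda>2 / a)"
    using integral_exp_period[of \<Lambda>2 a] integral_id_exp_period[of \<Lambda>2 a] \<Lambda> a ea
    by (simp add: set_integral_add(2)[OF si])
  finally have "cmod (fourier_coeff \<Lambda>2 (\<lambda>t. K * of_real t + K') n) = cmod K * (\<Lambda>2 / cmod a)"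
    using \<Lambda> by (simp add: norm_mult norm_divide)
  also have "\<dots> = C / \<bar>of_int n\<bar>"
    using \<Lambda> n by (simp add: a_def C_def norm_mult norm_divide power2_eq_square)
  finally show "C / \<bar>of_int n\<bar> \<le> cmod (fourier_coeff \<Lambda>2 (\<lambda>t. K * of_real t + K') n)" by simp
qed

text \<open>The weight turns the factor \<open>exp (\<mu> * \<Lambda>2)\<close> of the first
  equation into 1, so that its homogeneous solutions become periodic; the price is a modified
  \<open>\<beta>\<close>.\<close>

lemma exp_conjugation:
  fixes P :: "real \<Rightarrow> complex" and \<mu> :: complex
  defines "Q \<equiv> (\<lambda>t. exp (- \<mu> * of_real t) * P t)"
  shows "Q t - Q (t - \<Lambda>2) = exp (- \<mu> * of_real t) * (P t - exp (\<mu> * of_real \<Lambda>2) * P (t - \<Lambda>2))"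
    and "Q (t - \<Lambda>1) + (\<beta> * exp (\<mu> * of_real (\<Lambda>1 - \<Lambda>2))) * Q (t - \<Lambda>2)
      = exp (- \<mu> * of_real (t - \<Lambda>1)) * (P (t - \<Lambda>1) + \<beta> * P (t - \<Lambda>2))"
proof -
  have e1: "exp (- \<mu> * of_real (t - \<Lambda>2)) = exp (- \<mu> * of_real t) * exp (\<mu> * of_real \<Lambda>2)"
    unfolding exp_add[symmetric] by (simp add: algebra_simps)
  have e2: "exp (\<mu> * of_real (\<Lambda>1 - \<Lambda>2)) * exp (- \<mu> * of_real (t - \<Lambda>2)) = exp (- \<mu> * of_real (t - \<Lambda>1))"
    unfolding exp_add[symmetric] by (simp add: algebra_simps)
  show "Q t - Q (t - \<Lambda>2) = exp (- \<mu> * of_real t) * (P t - exp (\<mu> * of_real \<Lambda>2) * P (t - \<Lambda>2))"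
    unfolding Q_def e1 by (simp only: right_diff_distrib mult.assoc)
  show "Q (t - \<Lambda>1) + (\<beta> * exp (\<mu> * of_real (\<Lambda>1 - \<Lambda>2))) * Q (t - \<Lambda>2)
      = exp (- \<mu> * of_real (t - \<Lambda>1)) * (P (t - \<Lambda>1) + \<beta> * P (t - \<Lambda>2))"
    unfolding Q_def e2[symmetric] by (simp only: distrib_left distrib_right mult.assoc mult.left_commute)
qed

lemma L2loc_exp_mult: "L2loc f \<Longrightarrow> L2loc (\<lambda>t. exp (\<mu> * of_real t) * f t :: complex)"
  by (rule L2loc_cont_mult) (intro continuous_intros)

lemma reaches_conjugate:
  fixes P :: "real \<Rightarrow> complex" and \<mu> :: complex
  assumes P: "reaches \<Lambda>1 \<Lambda>2 0 (exp (\<mu> * of_real \<Lambda>2)) 1 \<beta> T yp yz P"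
  defines "Q \<equiv> (\<lambda>t. exp (- \<mu> * of_real t) * P t)"
  shows "L2loc Q"
    and "AE t in lborel. - \<Lambda>1 < t \<longrightarrow> t < 0 \<longrightarrow>
       Q t - Q (t - \<Lambda>2) = exp (- \<mu> * of_real t) * yp t \<and>
       Q (t - \<Lambda>1) + (\<beta> * exp (\<mu> * of_real (\<Lambda>1 - \<Lambda>2))) * Q (t - \<Lambda>2)
         = exp (- \<mu> * of_real (t - \<Lambda>1)) * yz t"
proof -
  show "L2loc Q" unfolding Q_def by (intro L2loc_exp_mult) (use P in \<open>simp add: reaches_def\<close>)
  have "AE t in lborel. - \<Lambda>1 < t \<longrightarrow> t < 0 \<longrightarrow>
        P t - exp (\<mu> * of_real \<Lambda>2) * P (t - \<Lambda>2) = yp t \<and> P (t - \<Lambda>1) + \<beta> * P (t - \<Lambda>2) = yz t"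
    using P by (simp add: reaches_def)
  then show "AE t in lborel. - \<Lambda>1 < t \<longrightarrow> t < 0 \<longrightarrow>
       Q t - Q (t - \<Lambda>2) = exp (- \<mu> * of_real t) * yp t \<and>
       Q (t - \<Lambda>1) + (\<beta> * exp (\<mu> * of_real (\<Lambda>1 - \<Lambda>2))) * Q (t - \<Lambda>2)
         = exp (- \<mu> * of_real (t - \<Lambda>1)) * yz t"
    unfolding Q_def exp_conjugation by eventually_elim simp
qed

text \<open>The target \<open>(0, 1)\<close> yields an exponential on the circle, with a jump at the
  end of the period unless \<open>\<mu> = 0\<close>. In that exceptional case the target
  \<open>(1, 0)\<close> yields an affine function instead.\<close>

lemma constants_nonresonant:
  assumes const: "\<And>cp cz. \<exists>P. reaches \<Lambda>1 \<Lambda>2 0 (exp (\<mu> * of_real \<Lambda>2)) 1 \<beta> T (\<lambda>_. cp) (\<lambda>_. cz) P"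
    and \<mu>: "exp (\<mu> * of_real \<Lambda>2) = 1 \<Longrightarrow> \<mu> = 0"
  shows "nonresonant \<Lambda>2 \<Lambda>1 (\<beta> * exp (\<mu> * of_real (\<Lambda>1 - \<Lambda>2)))"
proof -
  define \<rho> where "\<rho> = \<beta> * exp (\<mu> * of_real (\<Lambda>1 - \<Lambda>2))"
  obtain P where P: "reaches \<Lambda>1 \<Lambda>2 0 (exp (\<mu> * of_real \<Lambda>2)) 1 \<beta> T (\<lambda>_. 0) (\<lambda>_. 1) P"
    using const by blast
  note R = reaches_conjugate[OF P, folded \<rho>_def]
  obtain Q1 where Q1: "L2loc Q1" "periodic \<Lambda>2 Q1"
    "AE t in lborel. 0 < t \<longrightarrow> t < \<Lambda>2 \<longrightarrow>
       Q1 (t - \<Lambda>1) + \<rho> * Q1 t = exp (- \<mu> * of_real (t - \<Lambda>2 - \<Lambda>1))"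
    using circle_equation[OF R(1), of \<rho> "\<lambda>t. exp (- \<mu> * of_real (t - \<Lambda>1))"] R(2) by auto
  have "nonresonant \<Lambda>2 \<Lambda>1 \<rho>"
  proof (cases "exp (\<mu> * of_real \<Lambda>2) = 1")
    case False
    then have ne: "exp (- \<mu> * of_real \<Lambda>2) \<noteq> 1" by (simp add: exp_minus)
    have "exp (- \<mu> * of_real (t - \<Lambda>2 - \<Lambda>1)) = exp (\<mu> * of_real (\<Lambda>1 + \<Lambda>2)) * exp (- \<mu> * of_real t)" for t
      unfolding exp_add[symmetric] by (simp add: algebra_simps)
    then show ?thesis
      using Q1(3) by (intro nonresonant_exponential[OF Q1(1,2) _ ne]) auto
  next
    case True
    then have \<mu>0: "\<mu> = 0" by (rule \<mu>)
    \<comment> \<open>Frequency 0 of the equation for the target \<open>(0, 1)\<close> gives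
      \<open>1 + \<rho> \<noteq> 0\<close>, which will be the slope up to a factor.\<close>
    have "(character \<Lambda>2 (- 0) \<Lambda>1 + \<rho>) * fourier_coeff \<Lambda>2 Q1 0 = fourier_coeff \<Lambda>2 (\<lambda>_. 1) 0"
      using Q1(3) by (intro circle_fourier_coeff[OF \<Lambda>(1) Q1(1,2)]) (auto simp: \<mu>0)
    also have "fourier_coeff \<Lambda>2 (\<lambda>_. 1) 0 = of_real \<Lambda>2"
      using integral_character[OF \<Lambda>(1), of 0] by (simp add: fourier_coeff_def)
    finally have \<rho>1: "1 + \<rho> \<noteq> 0" using \<Lambda> by (auto simp: character_def)
    obtain P' where P': "reaches \<Lambda>1 \<Lambda>2 0 (exp (\<mu> * of_real \<Lambda>2)) 1 \<beta> T (\<lambda>_. 1) (\<lambda>_. 0) P'"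
      using const by blast
    note R' = reaches_conjugate[OF P', folded \<rho>_def, unfolded \<mu>0, simplified]
    \<comment> \<open>\<open>P'\<close> increases by 1 over each \<open>\<Lambda>2\<close>;
      subtracting the ramp \<open>t / \<Lambda>2\<close> makes it periodic and moves an affine term
      \<open>b\<close> to the right-hand side.\<close>
    define Q where "Q = (\<lambda>t. P' t - of_real (t / \<Lambda>2))"
    define b where "b = (\<lambda>t::real. - (of_real ((t - \<Lambda>1) / \<Lambda>2) + \<rho> * of_real ((t - \<Lambda>2) / \<Lambda>2)))"
    have "L2loc (\<lambda>t. of_real (t / \<Lambda>2) * (1::complex))"
      unfolding divide_inverse by (intro L2loc_cont_mult L2loc_const continuous_intros)
    then have "L2loc Q" unfolding Q_def using R'(1) by (intro L2loc_diff) auto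
    moreover have "AE t in lborel. - \<Lambda>1 < t \<longrightarrow> t < 0 \<longrightarrow>
       Q t - Q (t - \<Lambda>2) = 0 \<and> Q (t - \<Lambda>1) + \<rho> * Q (t - \<Lambda>2) = b t"
      using R'(2)
    proof eventually_elim
      case (elim t)
      show ?case
      proof (intro impI conjI)
        assume t: "- \<Lambda>1 < t" "t < 0"
        have "Q t - Q (t - \<Lambda>2) = (P' t - P' (t - \<Lambda>2)) - of_real (t / \<Lambda>2 - (t - \<Lambda>2) / \<Lambda>2)"
          unfolding Q_def by simp
        also have "t / \<Lambda>2 - (t - \<Lambda>2) / \<Lambda>2 = 1" using \<Lambda> by (simp add: diff_divide_distrib)
        finally show "Q t - Q (t - \<Lambda>2) = 0" using elim t by simp
        have "P' (t - \<Lambda>1) = - (\<rho> * P' (t - \<Lambda>2))" using elim t by (simp add: add_eq_0_iff2)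
        then show "Q (t - \<Lambda>1) + \<rho> * Q (t - \<Lambda>2) = b t"
          unfolding Q_def b_def by (simp add: right_diff_distrib)
      qed
    qed
    ultimately obtain Q2 where Q2: "L2loc Q2" "periodic \<Lambda>2 Q2"
      "AE t in lborel. 0 < t \<longrightarrow> t < \<Lambda>2 \<longrightarrow> Q2 (t - \<Lambda>1) + \<rho> * Q2 t = b (t - \<Lambda>2)"
      using circle_equation[of Q \<rho> b] by blast
    have "b (t - \<Lambda>2) = (- (1 + \<rho>) / \<Lambda>2) * of_real t + (of_real (\<Lambda>1 + \<Lambda>2) / \<Lambda>2 + 2 * \<rho>)" for t
      using \<Lambda> by (simp add: b_def field_simps)
    then show ?thesis
      using Q2(3) \<rho>1 \<Lambda>
      by (intro nonresonant_affine[OF Q2(1,2), of "- (1 + \<rho>) / \<Lambda>2" _ "of_real (\<Lambda>1 + \<Lambda>2) / \<Lambda>2 + 2 * \<rho>"])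
        (auto simp: add_eq_0_iff2)
  qed
  then show ?thesis by (simp add: \<rho>_def)
qed

text \<open>Nonresonance gives uniqueness, hence the horizon \<open>T \<ge> 2 * \<Lambda>1\<close>,
  and also solvability for arbitrary targets; the solution vanishes up to
  \<open>- 2 * \<Lambda>1\<close> and so up to \<open>- T\<close>.\<close>

lemma reaches_all_exponential:
  assumes T: "0 < T"
    and const: "\<And>cp cz. \<exists>P. reaches \<Lambda>1 \<Lambda>2 0 (exp (\<mu> * of_real \<Lambda>2)) 1 \<beta> T (\<lambda>_. cp) (\<lambda>_. cz) P"
    and \<mu>: "exp (\<mu> * of_real \<Lambda>2) = 1 \<Longrightarrow> \<mu> = 0"
    and y: "L2loc yp" "L2loc yz"
  shows "\<exists>P. reaches \<Lambda>1 \<Lambda>2 0 (exp (\<mu> * of_real \<Lambda>2)) 1 \<beta> T yp yz P"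
proof -
  define \<gamma> where "\<gamma> = exp (\<mu> * of_real \<Lambda>2)"
  define \<rho> where "\<rho> = \<beta> * exp (\<mu> * of_real (\<Lambda>1 - \<Lambda>2))"
  have nr: "nonresonant \<Lambda>2 \<Lambda>1 \<rho>"
    unfolding \<rho>_def by (rule constants_nonresonant[OF const \<mu>])
  \<comment> \<open>Targets of the equilibrium \<open>P = 1\<close>; \<open>Q\<close> below is the
    conjugated deviation from it and satisfies the homogeneous equations.\<close>
  obtain P where P: "reaches \<Lambda>1 \<Lambda>2 0 \<gamma> 1 \<beta> T (\<lambda>_. 1 - \<gamma>) (\<lambda>_. 1 + \<beta>) P"
    using const unfolding \<gamma>_def by blast
  define Q where "Q = (\<lambda>t. exp (- \<mu> * of_real t) * (P t - 1))"
  have "L2loc P" using P by (simp add: reaches_def)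
  then have QL: "L2loc Q" unfolding Q_def by (intro L2loc_exp_mult L2loc_diff L2loc_const)
  have "AE t in lborel. - \<Lambda>1 < t \<longrightarrow> t < 0 \<longrightarrow>
      P t - \<gamma> * P (t - \<Lambda>2) = 1 - \<gamma> \<and> P (t - \<Lambda>1) + \<beta> * P (t - \<Lambda>2) = 1 + \<beta>"
    using P by (simp add: reaches_def)
  then have Qeq: "AE t in lborel. - \<Lambda>1 < t \<longrightarrow> t < 0 \<longrightarrow>
      Q t - Q (t - \<Lambda>2) = 0 \<and> Q (t - \<Lambda>1) + \<rho> * Q (t - \<Lambda>2) = 0"
  proof eventually_elim
    case (elim t)
    show ?case
    proof (intro impI)
      assume t: "- \<Lambda>1 < t" "t < 0"
      have "(P t - 1) - \<gamma> * (P (t - \<Lambda>2) - 1) = 0" "(P (t - \<Lambda>1) - 1) + \<beta> * (P (t - \<Lambda>2) - 1) = 0"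
        using elim t by (auto simp: algebra_simps)
      then show "Q t - Q (t - \<Lambda>2) = 0 \<and> Q (t - \<Lambda>1) + \<rho> * Q (t - \<Lambda>2) = 0"
        unfolding Q_def \<rho>_def exp_conjugation[where \<mu> = \<mu> and P = "\<lambda>t. P t - 1"] \<gamma>_def[symmetric] by simp
    qed
  qed
  obtain Q1 where Q1: "L2loc Q1" "periodic \<Lambda>2 Q1"
    "AE t in lborel. - \<Lambda>1 - \<Lambda>2 < t \<longrightarrow> t < 0 \<longrightarrow> Q t = Q1 t"
    "AE t in lborel. 0 < t \<longrightarrow> t < \<Lambda>2 \<longrightarrow> Q1 (t - \<Lambda>1) + \<rho> * Q1 t = 0"
    using circle_equation[OF QL, of \<rho> "\<lambda>_. 0"] Qeq by auto
  have per: "periodic \<Lambda>2 (\<lambda>t. Q1 (t - \<Lambda>1) + \<rho> * Q1 t = 0)"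
    using Q1(2) unfolding periodic_def by (metis add.commute add_diff_eq)
  have zero: "AE t in lborel. Q1 t = 0"
    by (rule circle_unique[OF \<Lambda>(1) nr Q1(1,2) AE_periodic[OF \<Lambda>(1) per Q1(4)]])
  from zero Q1(3) AE_lborel_shift[OF zero, of "\<Lambda>1 - \<Lambda>2"] AE_lborel_shift[OF Q1(3), of "\<Lambda>1 - \<Lambda>2"]
    AE_lborel_shift[OF Qeq, of \<Lambda>1] AE_lborel_singleton[of "- \<Lambda>1 - \<Lambda>2"]
  have "AE t in lborel. - 2 * \<Lambda>1 < t \<longrightarrow> t < 0 \<longrightarrow> Q t = 0"
  proof eventually_elim
    case (elim t)
    show ?case
    proof (intro impI)
      assume t: "- 2 * \<Lambda>1 < t" "t < 0"
      show "Q t = 0"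
      proof (cases "- \<Lambda>1 - \<Lambda>2 < t")
        case True
        then show ?thesis using elim(1,2) t by simp
      next
        case False
        \<comment> \<open>Up to \<open>- \<Lambda>1 - \<Lambda>2\<close>, the second equation at
          \<open>t + \<Lambda>1\<close> expresses \<open>Q t\<close> by the later value
          \<open>Q (t + (\<Lambda>1 - \<Lambda>2))\<close>, already known to vanish.\<close>
        then have "Q (t + (\<Lambda>1 - \<Lambda>2)) = 0"
          using elim(3,4) t \<Lambda> by simp
        moreover have "Q (t + \<Lambda>1 - \<Lambda>1) + \<rho> * Q (t + \<Lambda>1 - \<Lambda>2) = 0"
          using elim(5) False t \<Lambda> by simp
        ultimately show ?thesis by (simp add: add_diff_eq)
      qed
    qed
  qed
  then have "AE t in lborel. - 2 * \<Lambda>1 < t \<longrightarrow> t < 0 \<longrightarrow> P t = 1"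
    by eventually_elim (simp add: Q_def)
  then have T2: "2 * \<Lambda>1 \<le> T"
    using horizon_ge[OF P] \<Lambda> T by simp
  define a where "a = (\<lambda>t. exp (- \<mu> * of_real t) * yp t)"
  define b where "b = (\<lambda>t. exp (- \<mu> * of_real (t - \<Lambda>1)) * yz t)"
  have "L2loc (\<lambda>t. exp (- \<mu> * of_real t) * (exp (\<mu> * of_real \<Lambda>1) * yz t))"
    by (intro L2loc_exp_mult L2loc_cmult y)
  moreover have "exp (- \<mu> * of_real (t - \<Lambda>1)) = exp (- \<mu> * of_real t) * exp (\<mu> * of_real \<Lambda>1)" for t
    unfolding exp_add[symmetric] by (simp add: algebra_simps)
  ultimately have "L2loc b" unfolding b_def by (simp only: mult.assoc)
  moreover have "L2loc a" unfolding a_def by (rule L2loc_exp_mult[OF y(1)])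
  ultimately have ab: "L2loc a" "L2loc b" by simp_all
  obtain Q where Q: "L2loc Q" "\<And>t. t \<le> - 2 * \<Lambda>1 \<Longrightarrow> Q t = 0"
    "AE t in lborel. - \<Lambda>1 < t \<longrightarrow> t < 0 \<longrightarrow>
       Q t - Q (t - \<Lambda>2) = a t \<and> Q (t - \<Lambda>1) + \<rho> * Q (t - \<Lambda>2) = b t"
    using solve_on_circle[OF nr ab] by blast
  define P where "P = (\<lambda>t. exp (\<mu> * of_real t) * Q t)"
  have "exp (- \<mu> * of_real t) * exp (\<mu> * of_real t) = 1" for t :: real
    unfolding exp_add[symmetric] by simp
  then have QP: "Q = (\<lambda>t. exp (- \<mu> * of_real t) * P t)"
    by (auto simp: P_def mult.assoc[symmetric])
  have "AE t in lborel. - \<Lambda>1 < t \<longrightarrow> t < 0 \<longrightarrow>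
      P t - \<gamma> * P (t - \<Lambda>2) = yp t \<and> P (t - \<Lambda>1) + \<beta> * P (t - \<Lambda>2) = yz t"
    using Q(3) unfolding QP \<rho>_def exp_conjugation \<gamma>_def[symmetric] a_def b_def
    by eventually_elim simp
  moreover have "L2loc P" unfolding P_def by (intro L2loc_exp_mult Q)
  moreover have "\<forall>t\<le>- T. P t = 0" using T2 Q(2) by (simp add: P_def)
  ultimately show ?thesis
    unfolding \<gamma>_def[symmetric] by (intro exI[of _ P]) (simp add: reaches_def)
qed

lemma reaches_all_short_delay:
  assumes T: "0 < T"
    and const: "\<And>cp cz. \<exists>P. reaches \<Lambda>1 \<Lambda>2 0 \<gamma> 1 \<beta> T (\<lambda>_. cp) (\<lambda>_. cz) P"
    and y: "L2loc yp" "L2loc yz"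
  shows "\<exists>P. reaches \<Lambda>1 \<Lambda>2 0 \<gamma> 1 \<beta> T yp yz P"
proof (cases "\<gamma> = 0")
  case True
  then show ?thesis using reaches_all_nilpotent[OF T _ y] const by simp
next
  case False
  \<comment> \<open>The principal logarithm has \<open>Ln 1 = 0\<close>, which ensures
    \<open>\<mu> = 0\<close> when \<open>\<gamma> = 1\<close>.\<close>
  define \<mu> where "\<mu> = Ln \<gamma> / of_real \<Lambda>2"
  have \<gamma>: "\<gamma> = exp (\<mu> * of_real \<Lambda>2)" using False \<Lambda> by (simp add: \<mu>_def)
  have "exp (\<mu> * of_real \<Lambda>2) = 1 \<Longrightarrow> \<mu> = 0" unfolding \<gamma>[symmetric] by (simp add: \<mu>_def)
  then show ?thesis
    using reaches_all_exponential[OF T const[unfolded \<gamma>] _ y] unfolding \<gamma> by blast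
qed

end

section \<open>The controlled system\<close>

lemma bounded_linear_matrix_vector_mult:
  fixes A :: "complex ^ 'n ^ 'm"
  shows "bounded_linear (\<lambda>x. A *v x)"
  by (intro linear_conv_bounded_linear[THEN iffD1] linearI)
    (simp_all add: vec_eq_iff matrix_vector_mult_def scaleR_sum_right distrib_left sum.distrib)

lemma bounded_linear_vector_smult: "bounded_linear (\<lambda>c. c *s (v :: complex ^ 'n))"
  by (intro linear_conv_bounded_linear[THEN iffD1] linearI)
    (simp_all add: vec_eq_iff distrib_right)

text \<open>Bilinear, without conjugation: \<open>dot2 w\<close> is the functional given by the row
  vector \<open>w\<close>.\<close>

definition dot2 :: "complex ^ 2 \<Rightarrow> complex ^ 2 \<Rightarrow> complex" where
  "dot2 w x = w $ 1 * x $ 1 + w $ 2 * x $ 2"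

definition det2 :: "complex ^ 2 \<Rightarrow> complex ^ 2 \<Rightarrow> complex" where
  "det2 v w = v $ 1 * w $ 2 - v $ 2 * w $ 1"

lemma dot2_add [simp]: "dot2 w (x + y) = dot2 w x + dot2 w y"
  and dot2_diff [simp]: "dot2 w (x - y) = dot2 w x - dot2 w y"
  and dot2_smult [simp]: "dot2 w (c *s x) = c * dot2 w x"
  and dot2_zero [simp]: "dot2 w 0 = 0"
  by (simp_all add: dot2_def algebra_simps)

lemma bounded_linear_dot2: "bounded_linear (dot2 w)"
  by (intro linear_conv_bounded_linear[THEN iffD1] linearI)
    (simp_all add: dot2_def algebra_simps)

lemma dot2_matrix: "dot2 w (A *v x) = dot2 (w v* A) x"
  by (simp add: dot2_def matrix_vector_mult_def vector_matrix_mult_def sum_2 algebra_simps)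

lemma dot2_parallel:
  assumes "w \<noteq> 0" "det2 w s = 0"
  obtains a where "\<And>x. dot2 s x = a * dot2 w x"
proof (cases "w $ 1 = 0")
  case True
  then have w2: "w $ 2 \<noteq> 0" using assms(1) by (auto simp: vec_eq_iff forall_2)
  then have "s $ 1 = 0" using assms(2) True by (simp add: det2_def)
  then show ?thesis using True w2 by (intro that[of "s $ 2 / w $ 2"]) (simp add: dot2_def)
next
  case False
  then have "s $ 2 = s $ 1 / w $ 1 * w $ 2" using assms(2) by (simp add: det2_def field_simps)
  then show ?thesis using False by (intro that[of "s $ 1 / w $ 1"]) (simp add: dot2_def algebra_simps)
qed

text \<open>Cramer's rule for \<open>s\<close> in the basis \<open>w\<close>, \<open>r\<close> of
  row vectors.\<close>

lemma dot2_decompose: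
  assumes "det2 w r \<noteq> 0"
  shows "dot2 s x = det2 s r / det2 w r * dot2 w x + det2 w s / det2 w r * dot2 r x"
proof -
  have "det2 w r * dot2 s x = det2 s r * dot2 w x + det2 w s * dot2 r x"
    by (simp add: dot2_def det2_def algebra_simps)
  then show ?thesis using assms by (simp add: field_simps)
qed

text \<open>The inverse of the coordinate map \<open>x \<mapsto> (dot2 w x, dot2 r x)\<close>, for
  \<open>det2 w r \<noteq> 0\<close>.\<close>

definition from_coords :: "complex ^ 2 \<Rightarrow> complex ^ 2 \<Rightarrow> complex \<Rightarrow> complex \<Rightarrow> complex ^ 2" where
  "from_coords w r z p = (z / det2 w r) *s vector [r $ 2, - r $ 1] + (p / det2 w r) *s vector [- w $ 2, w $ 1]"

lemma dot2_from_coords: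
  assumes "det2 w r \<noteq> 0"
  shows "dot2 w (from_coords w r z p) = z" "dot2 r (from_coords w r z p) = p"
proof -
  have "dot2 w (vector [r $ 2, - r $ 1]) = det2 w r" "dot2 r (vector [r $ 2, - r $ 1]) = 0"
    "dot2 w (vector [- w $ 2, w $ 1]) = 0" "dot2 r (vector [- w $ 2, w $ 1]) = det2 w r"
    by (simp_all add: dot2_def det2_def)
  then show "dot2 w (from_coords w r z p) = z" "dot2 r (from_coords w r z p) = p"
    using assms by (simp_all add: from_coords_def)
qed

lemma dot2_eqI:
  assumes "det2 w r \<noteq> 0" "dot2 w x = dot2 w y" "dot2 r x = dot2 r y"
  shows "x = y"
proof -
  have "dot2 (axis i 1) x = dot2 (axis i 1) y" for i
    unfolding dot2_decompose[OF assms(1), of "axis i 1"] assms(2,3) ..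
  from this[of 1] this[of 2] show ?thesis
    by (simp add: dot2_def axis_def vec_eq_iff forall_2)
qed

lemma is_solution_iff:
  "is_solution A1 A2 B \<Lambda>1 \<Lambda>2 T x0 u x \<longleftrightarrow>
     (AE t in lborel. - \<Lambda>1 < t \<longrightarrow> t < 0 \<longrightarrow> x t = x0 t) \<and>
     (AE t in lborel. 0 < t \<longrightarrow> t < T \<longrightarrow> x t = A1 *v x (t - \<Lambda>1) + A2 *v x (t - \<Lambda>2) + u t *s B)"
  by (simp add: is_solution_def L2_eq_def AE_lebesgue_on_interval)

lemma constant_states_const: "(\<lambda>_. c) \<in> constant_states \<Lambda>1"
  by (auto simp: constant_states_def state_space_def intro!: L2loc_imp_L2_space L2loc_const)

lemma constant_witness:
  assumes "exactly_controllable_to_constants A1 A2 B \<Lambda>1 \<Lambda>2 T"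
  obtains u x where "u \<in> control_space T" "is_solution A1 A2 B \<Lambda>1 \<Lambda>2 T (\<lambda>_. 0) u x"
    "AE s in lborel. - \<Lambda>1 < s \<longrightarrow> s < 0 \<longrightarrow> x (T + s) = c"
  using assms constant_states_const[of c \<Lambda>1]
  by (auto simp: exactly_controllable_to_constants_def L2_eq_def state_at_def AE_lebesgue_on_interval)

section \<open>Necessary conditions on the system from constant targets\<close>

context
  fixes A1 A2 :: "complex ^ 2 ^ 2" and B :: "complex ^ 2" and \<Lambda>1 \<Lambda>2 T :: real
  assumes \<Lambda>: "0 < \<Lambda>2" "\<Lambda>2 < \<Lambda>1" and T: "0 < T"
begin

lemma constants_exclude_invariant_functional:
  fixes f :: "complex ^ 2 \<Rightarrow> complex"
  assumes cc: "exactly_controllable_to_constants A1 A2 B \<Lambda>1 \<Lambda>2 T"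
    and f0: "f 0 = 0" and c: "f c \<noteq> 0"
    and step: "\<And>x y u. f x = 0 \<Longrightarrow> f y = 0 \<Longrightarrow> f (A1 *v x + A2 *v y + u *s B) = 0"
  shows False
proof -
  obtain u x where sol: "is_solution A1 A2 B \<Lambda>1 \<Lambda>2 T (\<lambda>_. 0) u x"
    and fin: "AE s in lborel. - \<Lambda>1 < s \<longrightarrow> s < 0 \<longrightarrow> x (T + s) = c"
    using constant_witness[OF cc, where c = c] by blast
  have \<Lambda>1: "0 < \<Lambda>1" using \<Lambda> by simp
  have "AE t in lborel. t < T \<longrightarrow> (- \<Lambda>1 < t \<longrightarrow> f (x t) = 0)"
  proof (rule AE_delay_induct[OF \<Lambda>1 \<Lambda>(1), where s = 0])
    have "AE t in lborel. - \<Lambda>1 < t \<longrightarrow> t < 0 \<longrightarrow> x t = 0"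
      using sol by (simp add: is_solution_iff)
    then show "AE t in lborel. t < 0 \<longrightarrow> - \<Lambda>1 < t \<longrightarrow> f (x t) = 0"
      by eventually_elim (use f0 in auto)
    have "AE t in lborel. 0 < t \<longrightarrow> t < T \<longrightarrow> x t = A1 *v x (t - \<Lambda>1) + A2 *v x (t - \<Lambda>2) + u t *s B"
      using sol by (simp add: is_solution_iff)
    then show "AE t in lborel. 0 < t \<longrightarrow> t < T \<longrightarrow> (- \<Lambda>1 < t - \<Lambda>1 \<longrightarrow> f (x (t - \<Lambda>1)) = 0) \<longrightarrow>
       (- \<Lambda>1 < t - \<Lambda>2 \<longrightarrow> f (x (t - \<Lambda>2)) = 0) \<longrightarrow> - \<Lambda>1 < t \<longrightarrow> f (x t) = 0"
      by eventually_elim (use \<Lambda> step in auto)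
  qed
  from AE_lborel_shift[OF this, of T] fin
  have "AE s in lborel. - \<Lambda>1 < s \<longrightarrow> s < 0 \<longrightarrow> f c = 0"
    by eventually_elim (use T in \<open>auto simp: add.commute\<close>)
  from AE_interval_witness[OF _ this] \<Lambda>1 c show False by auto
qed

section \<open>Passage between the controlled system and its flat output\<close>

context
  fixes w r :: "complex ^ 2" and g1 g2 c1 c2 :: complex
  assumes wB: "dot2 w B = 0" and wr: "det2 w r \<noteq> 0"
    and A1: "\<And>x. dot2 w (A1 *v x) = g1 * dot2 w x + c1 * dot2 r x"
    and A2: "\<And>x. dot2 w (A2 *v x) = g2 * dot2 w x + c2 * dot2 r x"
begin

text \<open>Solving the recursion for \<open>p\<close> defines \<open>P\<close>. Then
  \<open>z\<close> and \<open>c1 * P (t - \<Lambda>1) + c2 * P (t - \<Lambda>2)\<close> obey the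
  same recursion from a zero past, since translations commute, and hence coincide.\<close>

lemma constants_reaches:
  assumes cc: "exactly_controllable_to_constants A1 A2 B \<Lambda>1 \<Lambda>2 T"
  shows "\<exists>P. reaches \<Lambda>1 \<Lambda>2 g1 g2 c1 c2 T (\<lambda>_. cp) (\<lambda>_. cz) P"
proof -
  have \<Lambda>1: "0 < \<Lambda>1" using \<Lambda> by simp
  define c where "c = from_coords w r cz cp"
  obtain u x where u: "u \<in> control_space T" and sol: "is_solution A1 A2 B \<Lambda>1 \<Lambda>2 T (\<lambda>_. 0) u x"
    and fin: "AE s in lborel. - \<Lambda>1 < s \<longrightarrow> s < 0 \<longrightarrow> x (T + s) = c"
    using constant_witness[OF cc, where c = c] by blast
  obtain v where v: "L2loc v" "AE t in lborel. 0 < t \<longrightarrow> t < T \<longrightarrow> u t = v t"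
    using u unfolding control_space_def by (rule L2_space_representative)
  \<comment> \<open>A representative of the trajectory that is zero on the whole past and satisfies
    its equation at every point; uniqueness identifies it with \<open>x\<close> almost
    everywhere.\<close>
  obtain x' where x': "L2loc x'" "\<And>t. t \<le> 0 \<Longrightarrow> x' t = 0"
    "\<And>t. 0 < t \<Longrightarrow> t \<le> T \<Longrightarrow> x' t = A1 *v x' (t - \<Lambda>1) + A2 *v x' (t - \<Lambda>2) + v t *s B"
    using delay_recursion[OF \<Lambda>1 \<Lambda>(1) bounded_linear_matrix_vector_mult[of A1] bounded_linear_matrix_vector_mult[of A2]
      L2loc_const[of 0] L2loc_linear[OF bounded_linear_vector_smult v(1), of B], where s=0 and S=T] by metis
  have eq: "AE t in lborel. t < T \<longrightarrow> (- \<Lambda>1 < t \<longrightarrow> x t = x' t)"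
  proof (rule AE_delay_induct[OF \<Lambda>1 \<Lambda>(1), where s = 0])
    have "AE t in lborel. - \<Lambda>1 < t \<longrightarrow> t < 0 \<longrightarrow> x t = 0"
      using sol by (simp add: is_solution_iff)
    then show "AE t in lborel. t < 0 \<longrightarrow> - \<Lambda>1 < t \<longrightarrow> x t = x' t"
      by eventually_elim (simp add: x'(2))
    have "AE t in lborel. 0 < t \<longrightarrow> t < T \<longrightarrow> x t = A1 *v x (t - \<Lambda>1) + A2 *v x (t - \<Lambda>2) + u t *s B"
      using sol by (simp add: is_solution_iff)
    then show "AE t in lborel. 0 < t \<longrightarrow> t < T \<longrightarrow> (- \<Lambda>1 < t - \<Lambda>1 \<longrightarrow> x (t - \<Lambda>1) = x' (t - \<Lambda>1)) \<longrightarrow>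
       (- \<Lambda>1 < t - \<Lambda>2 \<longrightarrow> x (t - \<Lambda>2) = x' (t - \<Lambda>2)) \<longrightarrow> - \<Lambda>1 < t \<longrightarrow> x t = x' t"
      using v(2) by eventually_elim (use \<Lambda> x'(3) in auto)
  qed
  define p where "p = (\<lambda>t. dot2 r (x' (t + T)))"
  define z where "z = (\<lambda>t. dot2 w (x' (t + T)))"
  have pL: "L2loc p" unfolding p_def by (intro L2loc_linear[OF bounded_linear_dot2] L2loc_shift x')
  have p0: "p t = 0" and z0: "z t = 0" if "t \<le> - T" for t
    using that by (simp_all add: p_def z_def x'(2))
  have zrec: "z t = g1 * z (t - \<Lambda>1) + g2 * z (t - \<Lambda>2) + c1 * p (t - \<Lambda>1) + c2 * p (t - \<Lambda>2)"
    if "- T < t" "t < 0" for t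
  proof -
    have s: "t + T - \<Lambda>1 = t - \<Lambda>1 + T" "t + T - \<Lambda>2 = t - \<Lambda>2 + T" by simp_all
    then show ?thesis
      using x'(3)[of "t + T"] that wB by (simp add: z_def p_def A1 A2 s)
  qed
  obtain P where P: "L2loc P" "\<And>t. t \<le> - T \<Longrightarrow> P t = 0"
    "\<And>t. - T < t \<Longrightarrow> t \<le> 0 \<Longrightarrow> P t = g1 * P (t - \<Lambda>1) + g2 * P (t - \<Lambda>2) + p t"
    using delay_recursion[OF \<Lambda>1 \<Lambda>(1) bounded_linear_mult_right[of g1] bounded_linear_mult_right[of g2]
      L2loc_const[of 0] pL, where s = "- T" and S = 0] by metis
  \<comment> \<open>Also valid up to \<open>- T\<close>, where all terms vanish; the induction below
    evaluates it at delayed times.\<close>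
  have pP: "p t = P t - g1 * P (t - \<Lambda>1) - g2 * P (t - \<Lambda>2)" if "t \<le> 0" for t
    using P(2)[of t] P(2)[of "t - \<Lambda>1"] P(2)[of "t - \<Lambda>2"] P(3)[of t] p0[of t] that \<Lambda> by (cases "t \<le> - T") auto
  have "AE t in lborel. t < 0 \<longrightarrow> z t = c1 * P (t - \<Lambda>1) + c2 * P (t - \<Lambda>2)"
  proof (rule AE_delay_induct[OF \<Lambda>1 \<Lambda>(1), where s = "- T"])
    show "AE t in lborel. t < - T \<longrightarrow> z t = c1 * P (t - \<Lambda>1) + c2 * P (t - \<Lambda>2)"
      by (intro AE_I2) (use P(2) z0 \<Lambda> in auto)
    have "z t = c1 * P (t - \<Lambda>1) + c2 * P (t - \<Lambda>2)"
      if "- T < t" "t < 0" "z (t - \<Lambda>1) = c1 * P (t - \<Lambda>1 - \<Lambda>1) + c2 * P (t - \<Lambda>1 - \<Lambda>2)"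
        "z (t - \<Lambda>2) = c1 * P (t - \<Lambda>2 - \<Lambda>1) + c2 * P (t - \<Lambda>2 - \<Lambda>2)" for t
    proof -
      have "P (t - \<Lambda>2 - \<Lambda>1) = P (t - \<Lambda>1 - \<Lambda>2)" by (simp add: algebra_simps)
      moreover have "p (t - \<Lambda>1) = P (t - \<Lambda>1) - g1 * P (t - \<Lambda>1 - \<Lambda>1) - g2 * P (t - \<Lambda>1 - \<Lambda>2)"
        "p (t - \<Lambda>2) = P (t - \<Lambda>2) - g1 * P (t - \<Lambda>2 - \<Lambda>1) - g2 * P (t - \<Lambda>2 - \<Lambda>2)"
        using that(2) \<Lambda> by (intro pP; simp)+
      ultimately show ?thesis
        unfolding zrec[OF that(1,2)] that(3,4) by (simp only:) (simp add: algebra_simps)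
    qed
    then show "AE t in lborel. - T < t \<longrightarrow> t < 0 \<longrightarrow>
        z (t - \<Lambda>1) = c1 * P (t - \<Lambda>1 - \<Lambda>1) + c2 * P (t - \<Lambda>1 - \<Lambda>2) \<longrightarrow>
        z (t - \<Lambda>2) = c1 * P (t - \<Lambda>2 - \<Lambda>1) + c2 * P (t - \<Lambda>2 - \<Lambda>2) \<longrightarrow>
        z t = c1 * P (t - \<Lambda>1) + c2 * P (t - \<Lambda>2)"
      by (intro AE_I2) blast
  qed
  from this AE_lborel_shift[OF eq, of T] fin
  have "AE t in lborel. - \<Lambda>1 < t \<longrightarrow> t < 0 \<longrightarrow>
      P t - g1 * P (t - \<Lambda>1) - g2 * P (t - \<Lambda>2) = cp \<and> c1 * P (t - \<Lambda>1) + c2 * P (t - \<Lambda>2) = cz"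
  proof eventually_elim
    case (elim t)
    show ?case
    proof (intro impI)
      assume t: "- \<Lambda>1 < t" "t < 0"
      then have "x' (t + T) = c" using elim(2,3) T by (simp add: add.commute)
      then have "p t = cp" "z t = cz" using wr by (simp_all add: p_def z_def c_def dot2_from_coords)
      then show "P t - g1 * P (t - \<Lambda>1) - g2 * P (t - \<Lambda>2) = cp \<and> c1 * P (t - \<Lambda>1) + c2 * P (t - \<Lambda>2) = cz"
        using elim(1) t pP[of t] by simp
    qed
  qed
  then show ?thesis using P by (intro exI[of _ P]) (simp add: reaches_def)
qed

text \<open>By superposition, the controlled part only has to correct the final error of the free
  motion \<open>x1\<close>. A flat output reaching this error gives a trajectory from zero, and the
  defect in its uncontrolled equation is a multiple of \<open>B\<close> whose coefficient is the
  control.\<close>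

lemma reaches_exactly_controllable:
  assumes B: "B \<noteq> 0"
    and all: "\<And>yp yz. L2loc yp \<Longrightarrow> L2loc yz \<Longrightarrow> \<exists>P. reaches \<Lambda>1 \<Lambda>2 g1 g2 c1 c2 T yp yz P"
  shows "exactly_controllable A1 A2 B \<Lambda>1 \<Lambda>2 T"
  unfolding exactly_controllable_def
proof (intro ballI)
  fix x0 y assume x0: "x0 \<in> state_space \<Lambda>1" and y: "y \<in> state_space \<Lambda>1"
  obtain \<xi> where \<xi>: "L2loc \<xi>" "AE t in lborel. - \<Lambda>1 < t \<longrightarrow> t < 0 \<longrightarrow> x0 t = \<xi> t"
    using x0 unfolding state_space_def by (rule L2_space_representative)
  obtain \<eta> where \<eta>: "L2loc \<eta>" "AE t in lborel. - \<Lambda>1 < t \<longrightarrow> t < 0 \<longrightarrow> y t = \<eta> t"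
    using y unfolding state_space_def by (rule L2_space_representative)
  have \<Lambda>1: "0 < \<Lambda>1" using \<Lambda> by simp
  obtain x1 where x1: "L2loc x1" "\<And>t. t \<le> 0 \<Longrightarrow> x1 t = \<xi> t"
    "\<And>t. 0 < t \<Longrightarrow> t \<le> T \<Longrightarrow> x1 t = A1 *v x1 (t - \<Lambda>1) + A2 *v x1 (t - \<Lambda>2) + 0"
    using delay_recursion[OF \<Lambda>1 \<Lambda>(1) bounded_linear_matrix_vector_mult[of A1] bounded_linear_matrix_vector_mult[of A2]
      \<xi>(1) L2loc_const[of 0], where s=0 and S=T] by metis
  define e where "e = (\<lambda>t. \<eta> t - x1 (t + T))"
  have eL: "L2loc e" unfolding e_def by (intro L2loc_diff L2loc_shift \<eta> x1)
  obtain P where "reaches \<Lambda>1 \<Lambda>2 g1 g2 c1 c2 T (\<lambda>t. dot2 r (e t)) (\<lambda>t. dot2 w (e t)) P"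
    using all[OF L2loc_linear[OF bounded_linear_dot2 eL] L2loc_linear[OF bounded_linear_dot2 eL]] by blast
  then have P: "L2loc P" "\<And>t. t \<le> - T \<Longrightarrow> P t = 0"
    and Pe: "AE t in lborel. - \<Lambda>1 < t \<longrightarrow> t < 0 \<longrightarrow>
        P t - g1 * P (t - \<Lambda>1) - g2 * P (t - \<Lambda>2) = dot2 r (e t) \<and>
        c1 * P (t - \<Lambda>1) + c2 * P (t - \<Lambda>2) = dot2 w (e t)"
    by (auto simp: reaches_def)
  define p where "p = (\<lambda>t. P t - g1 * P (t - \<Lambda>1) - g2 * P (t - \<Lambda>2))"
  define z where "z = (\<lambda>t. c1 * P (t - \<Lambda>1) + c2 * P (t - \<Lambda>2))"
  have pz: "L2loc p" "L2loc z" unfolding p_def z_def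
    by (intro L2loc_diff L2loc_add L2loc_cmult L2loc_shift_minus P)+
  define X where "X = (\<lambda>t. from_coords w r (z t) (p t))"
  have XL: "L2loc X"
    unfolding X_def from_coords_def divide_inverse
    by (subst (1 2) mult.commute)
      (intro L2loc_add L2loc_linear[OF bounded_linear_vector_smult] L2loc_cmult pz)
  have Xw: "dot2 w (X t) = z t" and Xr: "dot2 r (X t) = p t" for t
    using wr by (simp_all add: X_def dot2_from_coords)
  have X0: "X t = 0" if "t \<le> - T" for t
    using that \<Lambda> by (simp add: X_def from_coords_def p_def z_def P(2))
  define x2 where "x2 = (\<lambda>t. X (t - T))"
  \<comment> \<open>The defect that the control has to supply. It is annihilated by
    \<open>w\<close>, because \<open>z\<close> and \<open>p\<close> built from one \<open>P\<close>
    satisfy the recursion for \<open>z\<close> identically.\<close>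
  define v where "v = (\<lambda>t. x2 t - A1 *v x2 (t - \<Lambda>1) - A2 *v x2 (t - \<Lambda>2))"
  have vL: "L2loc v" unfolding v_def x2_def
    by (intro L2loc_diff L2loc_linear[OF bounded_linear_matrix_vector_mult] L2loc_shift_minus XL
        L2loc_shift_minus[of "\<lambda>t. X (t - T)"])
  have wv: "dot2 w (v t) = 0" for t
  proof -
    have s: "t - \<Lambda>1 - T = t - T - \<Lambda>1" "t - \<Lambda>2 - T = t - T - \<Lambda>2"
      "t - T - \<Lambda>2 - \<Lambda>1 = t - T - \<Lambda>1 - \<Lambda>2" by simp_all
    show ?thesis
      by (simp add: v_def x2_def A1 A2 Xw Xr s) (simp add: z_def p_def s algebra_simps)
  qed
  \<comment> \<open>\<open>\<phi>\<close> reads the coefficient off a nonzero coordinate of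
    \<open>B\<close>; its linearity keeps the control square-integrable.\<close>
  define \<phi> where "\<phi> = (\<lambda>v::complex ^ 2. if B $ 1 = 0 then inverse (B $ 2) * v $ 2 else inverse (B $ 1) * v $ 1)"
  have \<phi>B: "v t = \<phi> (v t) *s B" for t
  proof -
    have w0: "w \<noteq> 0" using wr by (auto simp: det2_def)
    have wv': "w $ 1 * v t $ 1 + w $ 2 * v t $ 2 = 0" using wv[of t] by (simp add: dot2_def)
    have wB': "w $ 1 * B $ 1 + w $ 2 * B $ 2 = 0" using wB by (simp add: dot2_def)
    \<comment> \<open>In dimension two, two vectors annihilated by the same nonzero functional are
      parallel.\<close>
    have d: "v t $ 1 * B $ 2 = v t $ 2 * B $ 1"
    proof -
      have "w $ 1 * (v t $ 1 * B $ 2 - v t $ 2 * B $ 1) = 0" "w $ 2 * (v t $ 1 * B $ 2 - v t $ 2 * B $ 1) = 0"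
        using wv' wB' by algebra+
      then show ?thesis using w0 by (auto simp: vec_eq_iff forall_2)
    qed
    show ?thesis
    proof (cases "B $ 1 = 0")
      case True
      then have "B $ 2 \<noteq> 0" using B by (auto simp: vec_eq_iff forall_2)
      then show ?thesis using True d by (simp add: vec_eq_iff forall_2 \<phi>_def)
    next
      case False
      then have "v t $ 2 = inverse (B $ 1) * v t $ 1 * B $ 2" using d by (simp add: field_simps)
      then show ?thesis using False by (simp add: vec_eq_iff forall_2 \<phi>_def)
    qed
  qed
  have \<phi>L: "bounded_linear \<phi>" unfolding \<phi>_def
    by (intro linear_conv_bounded_linear[THEN iffD1] linearI) (simp_all add: distrib_left)
  define u where "u = (\<lambda>t. \<phi> (v t))"
  define x where "x = (\<lambda>t. x1 t + x2 t)"
  have "u \<in> control_space T"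
    unfolding control_space_def u_def by (intro L2loc_imp_L2_space L2loc_linear[OF \<phi>L] vL)
  moreover have "is_solution A1 A2 B \<Lambda>1 \<Lambda>2 T x0 u x"
    unfolding is_solution_iff
  proof
    show "AE t in lborel. - \<Lambda>1 < t \<longrightarrow> t < 0 \<longrightarrow> x t = x0 t"
      using \<xi>(2) by eventually_elim (simp add: x_def x1(2) x2_def X0)
    have "x t = A1 *v x (t - \<Lambda>1) + A2 *v x (t - \<Lambda>2) + u t *s B" if "0 < t" "t < T" for t
    proof -
      have "x2 t = A1 *v x2 (t - \<Lambda>1) + A2 *v x2 (t - \<Lambda>2) + u t *s B"
        using \<phi>B[of t] unfolding u_def by (simp add: v_def algebra_simps)
      then show ?thesis
        using x1(3)[of t] that by (simp add: x_def matrix_vector_right_distrib)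
    qed
    then show "AE t in lborel. 0 < t \<longrightarrow> t < T \<longrightarrow> x t = A1 *v x (t - \<Lambda>1) + A2 *v x (t - \<Lambda>2) + u t *s B"
      by (intro AE_I2) blast
  qed
  moreover have "L2_eq {- \<Lambda>1<..<0} (state_at x T) y"
    unfolding L2_eq_def AE_lebesgue_on_interval state_at_def
    using Pe \<eta>(2)
  proof eventually_elim
    case (elim t)
    show ?case
    proof (intro impI)
      assume t: "- \<Lambda>1 < t" "t < 0"
      have "X t = e t"
        using elim(1) t by (intro dot2_eqI[OF wr]) (simp_all add: Xw Xr p_def z_def)
      then show "x (T + t) = y t"
        using elim(2) t by (simp add: x_def x2_def e_def add.commute)
    qed
  qed
  ultimately show "\<exists>u\<in>control_space T. \<exists>x. is_solution A1 A2 B \<Lambda>1 \<Lambda>2 T x0 u x \<and>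
      L2_eq {- \<Lambda>1<..<0} (state_at x T) y"
    by blast
qed

end

end

section \<open>Choice of the free coordinate and the case distinction\<close>

theorem theorem5p9:
  fixes A1 A2 :: "complex ^ 2 ^ 2" and B :: "complex ^ 2" and \<Lambda>1 \<Lambda>2 T :: real
  assumes "\<Lambda>1 > \<Lambda>2" and "\<Lambda>2 > 0" and "T > 0"
  shows "exactly_controllable A1 A2 B \<Lambda>1 \<Lambda>2 T \<longleftrightarrow>
         exactly_controllable_to_constants A1 A2 B \<Lambda>1 \<Lambda>2 T"
proof
  assume ec: "exactly_controllable A1 A2 B \<Lambda>1 \<Lambda>2 T"
  have "(\<lambda>_. 0) \<in> state_space \<Lambda>1"
    unfolding state_space_def by (intro L2loc_imp_L2_space L2loc_const)
  then show "exactly_controllable_to_constants A1 A2 B \<Lambda>1 \<Lambda>2 T"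
    using ec by (auto simp: exactly_controllable_def exactly_controllable_to_constants_def constant_states_def)
next
  assume cc: "exactly_controllable_to_constants A1 A2 B \<Lambda>1 \<Lambda>2 T"
  note \<Lambda> = assms(2,1) and T = assms(3)
  have B: "B \<noteq> 0"
  proof
    assume "B = 0"
    \<comment> \<open>Without control the zero state persists; \<open>f\<close> detects whether a
      vector is nonzero.\<close>
    define f where "f = (\<lambda>x::complex ^ 2. if x = 0 then 0 else 1 :: complex)"
    show False
      by (rule constants_exclude_invariant_functional[OF \<Lambda> T cc, of f "axis 1 1"])
        (auto simp: f_def \<open>B = 0\<close> split: if_splits)
  qed
  \<comment> \<open>A row vector annihilating \<open>B\<close>, unique up to a factor.\<close>
  define w :: "complex ^ 2" where "w = vector [B $ 2, - B $ 1]"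
  have wB: "dot2 w B = 0" by (simp add: dot2_def w_def)
  have w0: "w \<noteq> 0" using B by (auto simp: w_def vec_eq_iff forall_2)
  define r1 where "r1 = w v* A1"
  define r2 where "r2 = w v* A2"
  have A: "dot2 w (A1 *v x) = dot2 r1 x" "dot2 w (A2 *v x) = dot2 r2 x" for x
    by (simp_all add: dot2_matrix r1_def r2_def)
  show "exactly_controllable A1 A2 B \<Lambda>1 \<Lambda>2 T"
  proof (cases "det2 w r1 = 0")
    case False
    \<comment> \<open>The row vector \<open>w v* A1\<close> is independent of \<open>w\<close> and
      is taken as the free coordinate, so \<open>g1 = 0\<close> and \<open>c1 = 1\<close>.\<close>
    define \<gamma> where "\<gamma> = det2 r2 r1 / det2 w r1"
    define \<beta> where "\<beta> = det2 w r2 / det2 w r1"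
    have A': "dot2 w (A1 *v x) = 0 * dot2 w x + 1 * dot2 r1 x"
      "dot2 w (A2 *v x) = \<gamma> * dot2 w x + \<beta> * dot2 r1 x" for x
      using dot2_decompose[OF False, of r2 x] by (simp_all add: A \<gamma>_def \<beta>_def)
    show ?thesis
      by (rule reaches_exactly_controllable[OF \<Lambda> T wB False A' B])
        (rule reaches_all_short_delay[OF \<Lambda> T constants_reaches[OF \<Lambda> T wB False A' cc]])
  next
    case True
    then obtain a where a: "\<And>x. dot2 r1 x = a * dot2 w x" using dot2_parallel[OF w0] by blast
    \<comment> \<open>Otherwise the coordinate \<open>dot2 w x\<close> would evolve autonomously
      from 0. So \<open>w v* A2\<close> can be the free coordinate, with \<open>g2 = 0\<close>,
      \<open>c1 = 0\<close> and \<open>c2 = 1\<close>.\<close>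
    have "det2 w r2 \<noteq> 0"
    proof
      assume "det2 w r2 = 0"
      then obtain b where b: "\<And>x. dot2 r2 x = b * dot2 w x" using dot2_parallel[OF w0] by blast
      have "\<exists>c. dot2 w c \<noteq> 0"
      proof (rule ccontr)
        assume "\<not> ?thesis"
        then have "dot2 w (axis i 1) = 0" for i by blast
        from this[of 1] this[of 2] w0 show False
          by (simp add: dot2_def axis_def vec_eq_iff forall_2)
      qed
      then obtain c where "dot2 w c \<noteq> 0" by blast
      then show False
        by (rule constants_exclude_invariant_functional[OF \<Lambda> T cc, rotated]) (simp_all add: A a b wB)
    qed
    moreover have A': "dot2 w (A1 *v x) = a * dot2 w x + 0 * dot2 r2 x"
      "dot2 w (A2 *v x) = 0 * dot2 w x + 1 * dot2 r2 x" for x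
      by (simp_all add: A a)
    ultimately show ?thesis
      by (intro reaches_exactly_controllable[OF \<Lambda> T wB _ A' B]
          reaches_all_long_delay[OF \<Lambda> T constants_reaches[OF \<Lambda> T wB _ A' cc]])
  qed
qed

end
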